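(* (i) The event $\{\widehat E^{(k)}=E^{(k)},\ \widehat S^{(k)}=S^{(k)},\ \widehat Z^{(k)}=Z^{(k)}\text{ for all }k\in[K]\}$ equals the event $\{\operatorname{sign}(\sqrt n\widehat B)=S,\ \widehat Z=Z\}$. (ii) Assume (R), (A1), (A2) and (A3). Take for $\sqrt n(\widehat\beta_E-\beta_{E,n},\widehat\beta^\perp_{-E},\Omega)$ its limiting Gaussian law $\mathcal{N}(\mathbf 0,\operatorname{blockdiag}(\mathcal{I}_{E,E}^{-1},\mathcal{I}/\mathcal{I}_{E,E},\Sigma_\Omega))$, and change variables from $\sqrt n\Omega$ to $(\sqrt n\widehat B,\widehat Z)$ through the linear map $\sqrt n\Omega\mapsto-\mathbb{Q}_1\sqrt n\widehat\beta_E+\mathbb{Q}_2\sqrt n\widehat B+\mathbf r$. Then the resulting (asymptotic) conditional density of $(\sqrt n\widehat\beta_E,\sqrt n\widehat B)$ given $\widehat Z=Z$ (and given $\widehat\beta^\perp_{-E}$), viewed as a likelihood in $\beta_{E,n}$, is $$p_Z(\beta_{E,n};\widehat\beta_E,\widehat\beta^\perp_{-E},\widehat B)\propto\varphi(\sqrt n\widehat\beta_E;\Pi\sqrt n\beta_{E,n}+\kappa,\Theta)\cdot\varphi(\sqrt n\widehat B;\Psi\sqrt n\widehat\beta_E+\tau,\Gamma),$$ where $\varphi(\cdot;\mu,\Sigma)$ is the Gaussian density with mean $\mu$ and covariance $\Sigma$; in particular it does not depend on $\widehat\beta^\perp_{-E}$.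
   Context: Setting. Observations $(y_i,x_i)\in\mathbb{R}\times\mathbb{R}^p$, $i\in[n]$, are i.i.d. The index set $[n]$ is partitioned into disjoint sets $\mathcal{C}^{(0)},\mathcal{C}^{(1)},\dots,\mathcal{C}^{(K)}$ (machine $0$ is the central machine, machines $1,\dots,K$ are local), with $n_k=|\mathcal{C}^{(k)}|$ and proportions $\rho_k=n_k/n\in(0,1)$ held fixed as $n\to\infty$, $\sum_{k=0}^K\rho_k=1$. $X\in\mathbb{R}^{n\times p}$ has rows $x_i^\top$ and $Y\in\mathbb{R}^n$ has entries $y_i$ for all $i\in[n]$ (all machines, including machine $0$); $X^{(k)},Y^{(k)}$ are the rows/entries with $i\in\mathcal{C}^{(k)}$. For $F\subseteq[p]$, $x_{i,F}$ and $X_F$ denote the subvector/columns indexed by $F$, $-F=[p]\setminus F$, and for a $p\times p$ matrix $M$, $M_{F,G}$ is the submatrix with rows in $F$ and columns in $G$, and $M_{\cdot,F}$ the columns in $F$. $A:\mathbb{R}\to\mathbb{R}$ is the cumulant function of an exponential-family GLM; for $u\in\mathbb{R}^m$, $\nabla A(u)=(A'(u_i))_i$ and $\nabla^2A(u)=(A''(u_i))_i$. $\Lambda=\operatorname{diag}(\lambda_1,\dots,\lambda_p)$ with $\lambda_j>0$. For $k\in[K]$, $\widehat\beta^{\Lambda,(k)}$ minimizes $\ell^{(k)}(\beta)+\|\Lambda\beta\|_1$ over $\beta\in\mathbb{R}^p$, where $\ell^{(k)}(\beta)=\frac{1}{\sqrt n\rho_k}\sum_{i\in\mathcal{C}^{(k)}}\{A(x_i^\top\beta)-y_ix_i^\top\beta\}$;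 $\widehat E^{(k)}=\{j:\widehat\beta^{\Lambda,(k)}_j\neq0\}$ with observed value $E^{(k)}$, and $E=\bigcup_{k=1}^KE^{(k)}$. In all asymptotic statements the sets $E^{(k)}$ and $E$ are treated as fixed (non-random). $\beta_{E,n}\in\mathbb{R}^{|E|}$ is the minimizer of $b\mapsto\mathbb{E}[\sum_{i\in[n]}\{A(x_{i,E}^\top b)-y_ix_{i,E}^\top b\}]$. $W=\operatorname{diag}(\nabla^2A(X_E\beta_{E,n}))$ and $\mathcal{I}=\mathbb{E}[\frac1nX^\top WX]\in\mathbb{R}^{p\times p}$, assumed positive definite and treated as fixed in the limit. Randomization variables: for $k\in[K]$, $\omega^{(k)}=\frac1nX^\top(\nabla A(X\widehat\beta^{\Lambda,(k)})-Y)-\frac1{n_k}X^{(k)\top}(\nabla A(X^{(k)}\widehat\beta^{\Lambda,(k)})-Y^{(k)})\in\mathbb{R}^p$, and $\Omega=(\omega^{(1)\top},\dots,\omega^{(K)\top})^\top\in\mathbb{R}^{pK}$. Aggregated MLE: for $k\in\{0,\dots,K\}$, $\widehat\beta^{(k)}_E$ is the maximum likelihood estimator in the GLM with predictors $E$ computed from $(X^{(k)},Y^{(k)})$; $\widehat{\mathcal{I}}^{(k)}_{E,E}=\frac1{n_k}X_E^{(k)\top}\operatorname{diag}(\nabla^2A(X^{(k)}_E\widehat\beta^{(k)}_E))X^{(k)}_E$; $\widehat{\mathcal{I}}_{E,E}=\sum_{k=0}^K\rho_k\widehat{\mathcal{I}}^{(k)}_{E,E}$; $\widehat\beta_E=\widehat{\mathcal{I}}_{E,E}^{-1}\sum_{k=0}^K\rho_k\widehat{\mathcal{I}}^{(k)}_{E,E}\widehat\beta^{(k)}_E$;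 and $\widehat\beta^\perp_{-E}=\frac1nX_{-E}^\top(\nabla A(X_E\widehat\beta_E)-Y)$. Lasso quantities: $\widehat B^{(k)}\in\mathbb{R}^{|E^{(k)}|}$ collects the nonzero entries of $\widehat\beta^{\Lambda,(k)}$, $\widehat S^{(k)}=\operatorname{sign}(\widehat B^{(k)})$; $\gamma^{(k)}=-\nabla\ell^{(k)}(\widehat\beta^{\Lambda,(k)})\in\mathbb{R}^p$ (so $\gamma^{(k)}_j=\lambda_j\operatorname{sign}(\widehat\beta^{\Lambda,(k)}_j)$ for $j\in E^{(k)}$), and $\widehat Z^{(k)}\in\mathbb{R}^{p-|E^{(k)}|}$ is defined by $\gamma^{(k)}_j=\lambda_j\widehat Z^{(k)}_j$ for $j\notin E^{(k)}$ (so $\|\widehat Z^{(k)}\|_\infty\le1$). $\widehat B,\widehat S,\widehat Z$ stack these over $k\in[K]$, with observed values $B,S,Z$; $\bar d=\sum_k|E^{(k)}|$. Matrices: $\Sigma_\Omega=U\otimes\mathcal{I}$, $U=\operatorname{diag}(\rho_1^{-1},\ldots,\rho_K^{-1})-\mathbf 1_K\mathbf 1_K^\top$. $\mathbb{Q}_1\in\mathbb{R}^{pK\times|E|}$ stacks $K$ copies of $\mathcal{I}_{\cdot,E}$; $\mathbb{Q}_2\in\mathbb{R}^{pK\times\bar d}$ is block diagonal with diagonal blocks $\mathcal{I}_{\cdot,E^{(1)}},\dots,\mathcal{I}_{\cdot,E^{(K)}}$. $\tilde b\in\mathbb{R}^p$ has $\tilde b_E=0$, $\tilde b_{-E}=\sqrt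 n\widehat\beta^\perp_{-E}$, and $\mathbf r\in\mathbb{R}^{pK}$ stacks $r^{(k)}=\gamma^{(k)}+\tilde b$, $k\in[K]$. Then $\Gamma=(\mathbb{Q}_2^\top\Sigma_\Omega^{-1}\mathbb{Q}_2)^{-1}$, $\Psi=\Gamma\mathbb{Q}_2^\top\Sigma_\Omega^{-1}\mathbb{Q}_1$, $\tau=-\Gamma\mathbb{Q}_2^\top\Sigma_\Omega^{-1}\mathbf r$, $\Theta=(\mathcal{I}_{E,E}+\mathbb{Q}_1^\top\Sigma_\Omega^{-1}\mathbb{Q}_1-\Psi^\top\Gamma^{-1}\Psi)^{-1}$, $\Pi=\Theta\mathcal{I}_{E,E}$, $\kappa=\Theta(\Psi^\top\Gamma^{-1}\tau+\mathbb{Q}_1^\top\Sigma_\Omega^{-1}\mathbf r)$. Regularity condition (R): $A$ is three times continuously differentiable; with $e_i=x_i(A'(x_{i,E}^\top\beta_{E,n})-y_i)$ one has $\mathbb{E}[e_i]=0$, $\operatorname{Cov}(e_i)\to\mathcal{I}$, and the $e_i$ satisfy a Lindeberg condition; empirical averages of $x_ix_i^\top A''(\cdot)$ over $[n]$ or over any $\mathcal{C}^{(k)}$, evaluated at parameter values within $O_p(n^{-1/2})$ of $\beta_{E,n}$ (or of the vectors $\mathcal{I}_{E^{(k)},E^{(k)}}^{-1}\mathcal{I}_{E^{(k)},E}\beta_{E,n}$), converge in probability to their expectations. Assumption (A1): for each $k\in[K]$ and each $j\in E\setminus E^{(k)}$, either the $j$-component of $\beta_{E,n}$ is $O(n^{-1/2})$,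 or $X_{E^{(k)}}\mathcal{I}_{E^{(k)},E^{(k)}}^{-1}\mathcal{I}_{E^{(k)},\{j\}}=X_j$. Assumption (A2): $\sqrt n(\widehat\beta_E-\beta_{E,n})=-\mathcal{I}_{E,E}^{-1}\frac1{\sqrt n}\sum_{i\in[n]}x_{i,E}(A'(x_{i,E}^\top\beta_{E,n})-y_i)+o_p(1)$. Assumption (A3): the law of $\sqrt n(\widehat\beta_E-\beta_{E,n},\widehat\beta^\perp_{-E},\Omega)$ is absolutely continuous on $\mathbb{R}^{p(K+1)}$ with densities $p_n$ that are bounded and absolutely equicontinuous. *)

theory Defs
  imports "HOL-Analysis.Analysis"
begin

text \<open>Vectors are functions from an index type to real, matrices are functions of two
indices; all operations only read entries inside the given finite index sets.\<close>

definition mvec :: "'j set \<Rightarrow> ('i \<Rightarrow> 'j \<Rightarrow> real) \<Rightarrow> ('j \<Rightarrow> real) \<Rightarrow> 'i \<Rightarrow> real" where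
  "mvec J M v = (\<lambda>i. \<Sum>j\<in>J. M i j * v j)"

definition mmul :: "'j set \<Rightarrow> ('i \<Rightarrow> 'j \<Rightarrow> real) \<Rightarrow> ('j \<Rightarrow> 'k \<Rightarrow> real) \<Rightarrow> 'i \<Rightarrow> 'k \<Rightarrow> real" where
  "mmul J A B = (\<lambda>i k. \<Sum>j\<in>J. A i j * B j k)"

definition mtr :: "('i \<Rightarrow> 'j \<Rightarrow> real) \<Rightarrow> 'j \<Rightarrow> 'i \<Rightarrow> real" where
  "mtr M = (\<lambda>i j. M j i)"

definition det_on :: "'i set \<Rightarrow> ('i \<Rightarrow> 'i \<Rightarrow> real) \<Rightarrow> real" where
  "det_on I M = (\<Sum>\<pi> \<in> {\<pi>. \<pi> permutes I}. of_int (sign \<pi>) * (\<Prod>i\<in>I. M i (\<pi> i)))"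

definition inv_on :: "'i set \<Rightarrow> ('i \<Rightarrow> 'i \<Rightarrow> real) \<Rightarrow> 'i \<Rightarrow> 'i \<Rightarrow> real" where
  "inv_on I M = (SOME N. (\<forall>i\<in>I. \<forall>j\<in>I. (\<Sum>k\<in>I. M i k * N k j) = (if i = j then 1 else 0))
                     \<and> (\<forall>i j. i \<notin> I \<or> j \<notin> I \<longrightarrow> N i j = 0))"

definition quad_form :: "'i set \<Rightarrow> ('i \<Rightarrow> 'i \<Rightarrow> real) \<Rightarrow> ('i \<Rightarrow> real) \<Rightarrow> real" where
  "quad_form I M v = (\<Sum>i\<in>I. \<Sum>j\<in>I. v i * M i j * v j)"

definition pos_def_on :: "'i set \<Rightarrow> ('i \<Rightarrow> 'i \<Rightarrow> real) \<Rightarrow> bool" where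
  "pos_def_on I M \<longleftrightarrow> (\<forall>i\<in>I. \<forall>j\<in>I. M i j = M j i) \<and>
                       (\<forall>v. (\<exists>i\<in>I. v i \<noteq> 0) \<longrightarrow> quad_form I M v > 0)"

definition gauss_density :: "'i set \<Rightarrow> ('i \<Rightarrow> real) \<Rightarrow> ('i \<Rightarrow> 'i \<Rightarrow> real) \<Rightarrow> ('i \<Rightarrow> real) \<Rightarrow> real" where
  "gauss_density I \<mu> \<Sigma> x =
     exp (- quad_form I (inv_on I \<Sigma>) (\<lambda>i. x i - \<mu> i) / 2) / sqrt ((2 * pi) ^ card I * det_on I \<Sigma>)"

text \<open>Covariates are indexed by \<open>{..<p}\<close>, observations by \<open>{..<n}\<close>; \<open>x i\<close> is the i-th row.\<close>

definition xdot :: "nat \<Rightarrow> (nat \<Rightarrow> real) \<Rightarrow> (nat \<Rightarrow> real) \<Rightarrow> real" where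
  "xdot p xi \<beta> = (\<Sum>j<p. xi j * \<beta> j)"

definition prop_of :: "nat \<Rightarrow> nat set \<Rightarrow> real" where
  "prop_of n C = real (card C) / real n"

definition glm_loss :: "(real \<Rightarrow> real) \<Rightarrow> nat \<Rightarrow> nat \<Rightarrow> nat set \<Rightarrow> (nat \<Rightarrow> nat \<Rightarrow> real) \<Rightarrow> (nat \<Rightarrow> real)
                         \<Rightarrow> (nat \<Rightarrow> real) \<Rightarrow> real" where
  "glm_loss A n p C x y \<beta> =
     (1 / (sqrt (real n) * prop_of n C)) * (\<Sum>i\<in>C. A (xdot p (x i) \<beta>) - y i * xdot p (x i) \<beta>)"

definition lasso_obj :: "(real \<Rightarrow> real) \<Rightarrow> nat \<Rightarrow> nat \<Rightarrow> nat set \<Rightarrow> (nat \<Rightarrow> real) \<Rightarrow> (nat \<Rightarrow> nat \<Rightarrow> real)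
                         \<Rightarrow> (nat \<Rightarrow> real) \<Rightarrow> (nat \<Rightarrow> real) \<Rightarrow> real" where
  "lasso_obj A n p C lam x y \<beta> = glm_loss A n p C x y \<beta> + (\<Sum>j<p. lam j * \<bar>\<beta> j\<bar>)"

definition neg_grad :: "(real \<Rightarrow> real) \<Rightarrow> nat \<Rightarrow> nat \<Rightarrow> nat set \<Rightarrow> (nat \<Rightarrow> nat \<Rightarrow> real) \<Rightarrow> (nat \<Rightarrow> real)
                         \<Rightarrow> (nat \<Rightarrow> real) \<Rightarrow> nat \<Rightarrow> real" where
  "neg_grad A n p C x y \<beta> =
     (\<lambda>j. - (1 / (sqrt (real n) * prop_of n C)) * (\<Sum>i\<in>C. x i j * (deriv A (xdot p (x i) \<beta>) - y i)))"

text \<open>Active set, vector of nonzero entries (a partial map with domain the active set),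
its signs, and the scaled inactive subgradient \<open>Z\<close> (partial map with domain the inactive set).\<close>
definition active :: "nat \<Rightarrow> (nat \<Rightarrow> real) \<Rightarrow> nat set" where
  "active p \<beta> = {j. j < p \<and> \<beta> j \<noteq> 0}"

definition Bmap :: "nat \<Rightarrow> (nat \<Rightarrow> real) \<Rightarrow> nat \<rightharpoonup> real" where
  "Bmap p \<beta> = (\<lambda>j. if j \<in> active p \<beta> then Some (\<beta> j) else None)"

definition Smap :: "nat \<Rightarrow> (nat \<Rightarrow> real) \<Rightarrow> nat \<rightharpoonup> real" where
  "Smap p \<beta> = (\<lambda>j. map_option sgn (Bmap p \<beta> j))"

definition Zmap :: "nat \<Rightarrow> (nat \<Rightarrow> real) \<Rightarrow> (nat \<Rightarrow> real) \<Rightarrow> (nat \<Rightarrow> real) \<Rightarrow> nat \<rightharpoonup> real" where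
  "Zmap p lam \<beta> \<gamma> = (\<lambda>j. if j < p \<and> j \<notin> active p \<beta> then Some (\<gamma> j / lam j) else None)"

definition stack :: "nat \<Rightarrow> (nat \<Rightarrow> nat \<rightharpoonup> real) \<Rightarrow> nat \<times> nat \<rightharpoonup> real" where
  "stack K f = (\<lambda>(k, j). if k \<in> {1..K} then f k j else None)"

definition PKset :: "nat \<Rightarrow> nat \<Rightarrow> (nat \<times> nat) set" where
  "PKset K p = {1..K} \<times> {..<p}"

definition Dset :: "nat \<Rightarrow> (nat \<Rightarrow> nat set) \<Rightarrow> (nat \<times> nat) set" where
  "Dset K Ek = Sigma {1..K} Ek"

text \<open>\<open>\<Sigma>_\<Omega> = U \<otimes> \<I>\<close>, \<open>U = diag(1/\<rho>_k) - 1 1^T\<close>.\<close>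
definition SigmaOmega :: "(nat \<Rightarrow> real) \<Rightarrow> (nat \<Rightarrow> nat \<Rightarrow> real) \<Rightarrow> nat \<times> nat \<Rightarrow> nat \<times> nat \<Rightarrow> real" where
  "SigmaOmega \<rho> Info = (\<lambda>(k, j) (k', j'). ((if k = k' then 1 / \<rho> k else 0) - 1) * Info j j')"

definition Q1 :: "(nat \<Rightarrow> nat \<Rightarrow> real) \<Rightarrow> nat \<times> nat \<Rightarrow> nat \<Rightarrow> real" where
  "Q1 Info = (\<lambda>(k, j) e. Info j e)"

definition Q2 :: "(nat \<Rightarrow> nat \<Rightarrow> real) \<Rightarrow> nat \<times> nat \<Rightarrow> nat \<times> nat \<Rightarrow> real" where
  "Q2 Info = (\<lambda>(k, j) (k', e). if k = k' then Info j e else 0)"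

definition schur :: "nat set \<Rightarrow> (nat \<Rightarrow> nat \<Rightarrow> real) \<Rightarrow> nat \<Rightarrow> nat \<Rightarrow> real" where
  "schur E Info = (\<lambda>i j. Info i j - (\<Sum>a\<in>E. \<Sum>b\<in>E. Info i a * inv_on E Info a b * Info b j))"

text \<open>In the following: K machines, p covariates, \<rho> proportions, Info = \<I>, Ek k = E^{(k)},
E = union of the Ek, r the stacked vector r.\<close>

definition SigInv where
  "SigInv K p \<rho> Info = inv_on (PKset K p) (SigmaOmega \<rho> Info)"

definition GammaM :: "nat \<Rightarrow> nat \<Rightarrow> (nat \<Rightarrow> real) \<Rightarrow> (nat \<Rightarrow> nat \<Rightarrow> real) \<Rightarrow> (nat \<Rightarrow> nat set)
                      \<Rightarrow> nat \<times> nat \<Rightarrow> nat \<times> nat \<Rightarrow> real" where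
  "GammaM K p \<rho> Info Ek = inv_on (Dset K Ek)
      (mmul (PKset K p) (mtr (Q2 Info)) (mmul (PKset K p) (SigInv K p \<rho> Info) (Q2 Info)))"

definition PsiM :: "nat \<Rightarrow> nat \<Rightarrow> (nat \<Rightarrow> real) \<Rightarrow> (nat \<Rightarrow> nat \<Rightarrow> real) \<Rightarrow> (nat \<Rightarrow> nat set)
                      \<Rightarrow> nat \<times> nat \<Rightarrow> nat \<Rightarrow> real" where
  "PsiM K p \<rho> Info Ek = mmul (Dset K Ek) (GammaM K p \<rho> Info Ek)
      (mmul (PKset K p) (mtr (Q2 Info)) (mmul (PKset K p) (SigInv K p \<rho> Info) (Q1 Info)))"

definition tauV :: "nat \<Rightarrow> nat \<Rightarrow> (nat \<Rightarrow> real) \<Rightarrow> (nat \<Rightarrow> nat \<Rightarrow> real) \<Rightarrow> (nat \<Rightarrow> nat set)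
                      \<Rightarrow> (nat \<times> nat \<Rightarrow> real) \<Rightarrow> nat \<times> nat \<Rightarrow> real" where
  "tauV K p \<rho> Info Ek r = (\<lambda>i. - mvec (Dset K Ek) (GammaM K p \<rho> Info Ek)
      (mvec (PKset K p) (mtr (Q2 Info)) (mvec (PKset K p) (SigInv K p \<rho> Info) r)) i)"

definition ThetaM :: "nat \<Rightarrow> nat \<Rightarrow> (nat \<Rightarrow> real) \<Rightarrow> (nat \<Rightarrow> nat \<Rightarrow> real) \<Rightarrow> (nat \<Rightarrow> nat set)
                      \<Rightarrow> nat \<Rightarrow> nat \<Rightarrow> real" where
  "ThetaM K p \<rho> Info Ek = (let E = (\<Union>k\<in>{1..K}. Ek k); D = Dset K Ek; P = PKset K p;
      Psi = PsiM K p \<rho> Info Ek in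
      inv_on E (\<lambda>a b. Info a b
        + mmul P (mtr (Q1 Info)) (mmul P (SigInv K p \<rho> Info) (Q1 Info)) a b
        - mmul D (mtr Psi) (mmul D (inv_on D (GammaM K p \<rho> Info Ek)) Psi) a b))"

definition PiM :: "nat \<Rightarrow> nat \<Rightarrow> (nat \<Rightarrow> real) \<Rightarrow> (nat \<Rightarrow> nat \<Rightarrow> real) \<Rightarrow> (nat \<Rightarrow> nat set)
                      \<Rightarrow> nat \<Rightarrow> nat \<Rightarrow> real" where
  "PiM K p \<rho> Info Ek = mmul (\<Union>k\<in>{1..K}. Ek k) (ThetaM K p \<rho> Info Ek) Info"

definition kappaV :: "nat \<Rightarrow> nat \<Rightarrow> (nat \<Rightarrow> real) \<Rightarrow> (nat \<Rightarrow> nat \<Rightarrow> real) \<Rightarrow> (nat \<Rightarrow> nat set)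
                      \<Rightarrow> (nat \<times> nat \<Rightarrow> real) \<Rightarrow> nat \<Rightarrow> real" where
  "kappaV K p \<rho> Info Ek r = (let E = (\<Union>k\<in>{1..K}. Ek k); D = Dset K Ek; P = PKset K p;
      Psi = PsiM K p \<rho> Info Ek in
      mvec E (ThetaM K p \<rho> Info Ek)
        (\<lambda>a. mvec D (mtr Psi) (mvec D (inv_on D (GammaM K p \<rho> Info Ek)) (tauV K p \<rho> Info Ek r)) a
           + mvec P (mtr (Q1 Info)) (mvec P (SigInv K p \<rho> Info) r) a))"

text \<open>r(k,j) = gamma(k,j) + btilde(j), where gamma(k,j) = lam_j S_j on E(k), lam_j Z_j off E(k);
btilde equals v = sqrt n * betaperp off E and is zero on E.\<close>
definition rV :: "nat \<Rightarrow> (nat \<Rightarrow> nat set) \<Rightarrow> (nat \<Rightarrow> real) \<Rightarrow> (nat \<times> nat \<rightharpoonup> real) \<Rightarrow> (nat \<times> nat \<rightharpoonup> real)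
                   \<Rightarrow> (nat \<Rightarrow> real) \<Rightarrow> nat \<times> nat \<Rightarrow> real" where
  "rV K Ek lam S Z v = (\<lambda>(k, j).
      lam j * (if j \<in> Ek k then the (S (k, j)) else the (Z (k, j)))
      + (if j \<in> (\<Union>k'\<in>{1..K}. Ek k') then 0 else v j))"

end

theory Submission
  imports Defs "Jordan_Normal_Form.Determinant"
begin

(* Part (i) is bookkeeping: multiplying by sqrt n > 0 does not change signs, and the stacked
   sign vector determines the active sets.

   Part (ii) is completing the square.  Put S = Sigma_Omega^-1, W = -Q1 b + Q2 B + r and
   mu = sqrt n beta_{E,n}.  Splitting W S-orthogonally into its component in the range of Q2
   and a residual gives
     W^T S W = (B - Psi b - tau)^T Gamma^-1 (B - Psi b - tau) + (residual)^T S (residual)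
   with Gamma^-1 = Q2^T S Q2.  The residual is affine in b, and since
   Theta^-1 = I_EE + L^T S L for the residual map L = Q1 - Q2 Psi, its b-dependent part
   combines with (b - mu)^T I_EE (b - mu) into (b - Pi mu - kappa)^T Theta^-1 (b - Pi mu - kappa)
   up to a constant.  The factor for sqrt n betahat_perp does not involve (b, B) at all.
   Every normalising constant is positive: Sigma_Omega is positive definite because
   sum_k rho_k < 1 (machine 0 holds data), Gamma^-1 because Q2 is injective, and Theta^-1
   because I_EE is. *)

section \<open>Linear algebra on finite index sets\<close>

definition dot_on :: "'i set \<Rightarrow> ('i \<Rightarrow> real) \<Rightarrow> ('i \<Rightarrow> real) \<Rightarrow> real" where
  "dot_on I x y = (\<Sum>i\<in>I. x i * y i)"

definition symm_on :: "'i set \<Rightarrow> ('i \<Rightarrow> 'i \<Rightarrow> real) \<Rightarrow> bool" where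
  "symm_on I M \<longleftrightarrow> (\<forall>i\<in>I. \<forall>j\<in>I. M i j = M j i)"

definition rinv_on :: "'i set \<Rightarrow> ('i \<Rightarrow> 'i \<Rightarrow> real) \<Rightarrow> ('i \<Rightarrow> 'i \<Rightarrow> real) \<Rightarrow> bool" where
  "rinv_on I M N \<longleftrightarrow> (\<forall>i\<in>I. \<forall>j\<in>I. (\<Sum>k\<in>I. M i k * N k j) = (if i = j then 1 else 0))"

lemma mvec_cong:
  "(\<And>j. j \<in> J \<Longrightarrow> M i j = N i j) \<Longrightarrow> (\<And>j. j \<in> J \<Longrightarrow> x j = y j) \<Longrightarrow> mvec J M x i = mvec J N y i"
  by (simp add: mvec_def)

lemma mvec_add: "mvec J M (\<lambda>j. x j + y j) = (\<lambda>i. mvec J M x i + mvec J M y i)"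
  by (simp add: mvec_def distrib_left sum.distrib)

lemma mvec_diff: "mvec J M (\<lambda>j. x j - y j) = (\<lambda>i. mvec J M x i - mvec J M y i)"
  by (simp add: mvec_def right_diff_distrib sum_subtractf)

lemma mvec_minus: "mvec J M (\<lambda>j. - x j) = (\<lambda>i. - mvec J M x i)"
  by (simp add: mvec_def sum_negf)

lemma mvec_scale: "mvec J M (\<lambda>j. c * x j) = (\<lambda>i. c * mvec J M x i)"
  by (simp add: mvec_def sum_distrib_left mult.left_commute)

lemma mvec_sum: "mvec J M (\<lambda>j. \<Sum>k\<in>K. f k j) = (\<lambda>i. \<Sum>k\<in>K. mvec J M (f k) i)"
  unfolding mvec_def sum_distrib_left by (rule ext) (rule sum.swap)

lemma mvec_mat_diff: "mvec J (\<lambda>a b. A a b - B a b) z = (\<lambda>i. mvec J A z i - mvec J B z i)"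
  by (simp add: mvec_def left_diff_distrib sum_subtractf)

lemma mvec_mat_add_diff:
  "mvec J (\<lambda>a b. A a b + B a b - C a b) z = (\<lambda>i. mvec J A z i + mvec J B z i - mvec J C z i)"
  by (simp add: mvec_def distrib_right left_diff_distrib sum.distrib sum_subtractf)

lemma mvec_mmul: "mvec K (mmul J A B) v = mvec J A (mvec K B v)"
  unfolding mvec_def mmul_def
  by (simp add: sum_distrib_left sum_distrib_right mult.assoc sum.swap[of _ J K])

lemma mtr_mtr [simp]: "mtr (mtr A) = A"
  by (simp add: mtr_def)

lemma dot_on_cong:
  "(\<And>i. i \<in> I \<Longrightarrow> x i = x' i) \<Longrightarrow> (\<And>i. i \<in> I \<Longrightarrow> y i = y' i) \<Longrightarrow> dot_on I x y = dot_on I x' y'"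
  by (simp add: dot_on_def)

lemma dot_on_commute: "dot_on I x y = dot_on I y x"
  by (simp add: dot_on_def mult.commute)

lemma dot_on_add_left: "dot_on I (\<lambda>i. x i + y i) z = dot_on I x z + dot_on I y z"
  by (simp add: dot_on_def distrib_right sum.distrib)

lemma dot_on_add_right: "dot_on I z (\<lambda>i. x i + y i) = dot_on I z x + dot_on I z y"
  by (simp add: dot_on_def distrib_left sum.distrib)

lemma dot_on_diff_left: "dot_on I (\<lambda>i. x i - y i) z = dot_on I x z - dot_on I y z"
  by (simp add: dot_on_def left_diff_distrib sum_subtractf)

lemma dot_on_diff_right: "dot_on I z (\<lambda>i. x i - y i) = dot_on I z x - dot_on I z y"
  by (simp add: dot_on_def right_diff_distrib sum_subtractf)

lemma dot_on_minus_right: "dot_on I z (\<lambda>i. - x i) = - dot_on I z x"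
  by (simp add: dot_on_def sum_negf)

lemma dot_on_minus_left: "dot_on I (\<lambda>i. - x i) z = - dot_on I x z"
  by (simp add: dot_on_def sum_negf)

lemma dot_on_scale_right: "dot_on I z (\<lambda>i. c * x i) = c * dot_on I z x"
  by (simp add: dot_on_def sum_distrib_left mult.left_commute)

lemma dot_on_sum_left: "dot_on J (\<lambda>j. \<Sum>k\<in>K. f k j) y = (\<Sum>k\<in>K. dot_on J (f k) y)"
  unfolding dot_on_def sum_distrib_right by (rule sum.swap)

lemma dot_on_sum_right: "dot_on J x (\<lambda>i. \<Sum>k\<in>K. g k i) = (\<Sum>k\<in>K. dot_on J x (g k))"
  unfolding dot_on_def sum_distrib_left by (rule sum.swap)

lemma dot_on_mvec_mtr: "dot_on I x (mvec J M y) = dot_on J (mvec I (mtr M) x) y"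
  unfolding dot_on_def mvec_def mtr_def
  by (simp add: sum_distrib_left sum_distrib_right mult.assoc mult.left_commute sum.swap[of _ I J])

lemma dot_on_mvec_symm:
  assumes "symm_on I M"
  shows "dot_on I x (mvec I M y) = dot_on I y (mvec I M x)"
proof -
  have "dot_on I x (mvec I M y) = dot_on I (mvec I (mtr M) x) y"
    by (rule dot_on_mvec_mtr)
  also have "\<dots> = dot_on I (mvec I M x) y"
    using assms by (intro dot_on_cong mvec_cong) (auto simp: symm_on_def mtr_def)
  finally show ?thesis by (simp add: dot_on_commute)
qed

lemma quad_form_dot_on: "quad_form I M x = dot_on I x (mvec I M x)"
  unfolding quad_form_def dot_on_def mvec_def by (simp add: sum_distrib_left mult.assoc)

lemma quad_form_cong:
  "(\<And>i j. i \<in> I \<Longrightarrow> j \<in> I \<Longrightarrow> M i j = N i j) \<Longrightarrow> (\<And>i. i \<in> I \<Longrightarrow> v i = w i)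
    \<Longrightarrow> quad_form I M v = quad_form I N w"
  by (simp add: quad_form_def)

lemma quad_form_diff:
  assumes "symm_on I M"
  shows "quad_form I M (\<lambda>i. x i - y i) = quad_form I M x - 2 * dot_on I x (mvec I M y) + quad_form I M y"
  using dot_on_mvec_symm[OF assms, of y x]
  unfolding quad_form_dot_on mvec_diff dot_on_diff_left dot_on_diff_right by simp

lemma quad_form_add:
  assumes "symm_on I M"
  shows "quad_form I M (\<lambda>i. x i + y i) = quad_form I M x + 2 * dot_on I x (mvec I M y) + quad_form I M y"
  using dot_on_mvec_symm[OF assms, of y x]
  unfolding quad_form_dot_on mvec_add dot_on_add_left dot_on_add_right by simp

lemma quad_form_minus: "quad_form I M (\<lambda>i. - x i) = quad_form I M x"
  by (simp add: quad_form_def)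

lemma quad_form_scale: "quad_form I M (\<lambda>i. c * x i) = c * c * quad_form I M x"
  by (simp add: quad_form_def sum_distrib_left mult_ac)

lemma quad_form_lincomb:
  "quad_form I (\<lambda>i j. a * A i j + b * B i j) v = a * quad_form I A v + b * quad_form I B v"
  unfolding quad_form_def by (simp add: algebra_simps sum.distrib sum_distrib_left)

lemma mvec_restrict:
  assumes "finite J" "E \<subseteq> J"
  shows "mvec J M (\<lambda>j. if j \<in> E then x j else 0) = mvec E M x"
proof
  fix i
  have "mvec J M (\<lambda>j. if j \<in> E then x j else 0) i = (\<Sum>j\<in>J. if j \<in> E then M i j * x j else 0)"
    unfolding mvec_def by (intro sum.cong) auto
  also have "\<dots> = mvec E M x i"
    using sum.inter_restrict[OF assms(1), of "\<lambda>j. M i j * x j" E] assms(2)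
    by (simp add: mvec_def Int_absorb1)
  finally show "mvec J M (\<lambda>j. if j \<in> E then x j else 0) i = mvec E M x i" .
qed

lemma dot_on_restrict:
  assumes "finite J" "E \<subseteq> J"
  shows "dot_on J (\<lambda>j. if j \<in> E then x j else 0) y = dot_on E x y"
proof -
  have "dot_on J (\<lambda>j. if j \<in> E then x j else 0) y = (\<Sum>j\<in>J. if j \<in> E then x j * y j else 0)"
    unfolding dot_on_def by (intro sum.cong) auto
  then show ?thesis
    using sum.inter_restrict[OF assms(1), of "\<lambda>j. x j * y j" E] assms(2)
    by (simp add: dot_on_def Int_absorb1)
qed

lemma quad_form_restrict:
  assumes "finite J" "E \<subseteq> J"
  shows "quad_form J M (\<lambda>j. if j \<in> E then x j else 0) = quad_form E M x"
  by (simp add: quad_form_dot_on dot_on_restrict[OF assms] mvec_restrict[OF assms])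

lemma rinv_on_mvec:
  assumes "finite I" "rinv_on I M N" "i \<in> I"
  shows "mvec I M (mvec I N x) i = x i"
proof -
  have "mvec I M (mvec I N x) i = (\<Sum>j\<in>I. (\<Sum>k\<in>I. M i k * N k j) * x j)"
    using fun_cong[OF mvec_mmul[of I I M N x], of i] by (simp add: mmul_def mvec_def)
  also have "\<dots> = (\<Sum>j\<in>I. if i = j then x j else 0)"
    using assms(2,3) by (intro sum.cong) (auto simp: rinv_on_def)
  finally show ?thesis using assms(1,3) by simp
qed

lemma pos_def_on_symm: "pos_def_on I M \<Longrightarrow> symm_on I M"
  by (simp add: pos_def_on_def symm_on_def)

lemma quad_form_pos: "pos_def_on I M \<Longrightarrow> i \<in> I \<Longrightarrow> v i \<noteq> 0 \<Longrightarrow> quad_form I M v > 0"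
  unfolding pos_def_on_def by blast

lemma quad_form_nonneg: "pos_def_on I M \<Longrightarrow> quad_form I M v \<ge> 0"
  unfolding pos_def_on_def quad_form_def by (cases "\<exists>i\<in>I. v i \<noteq> 0") (auto intro: less_imp_le)

lemma pos_def_on_subset:
  assumes "finite I" "J \<subseteq> I" "pos_def_on I M"
  shows "pos_def_on J M"
  unfolding pos_def_on_def
proof (intro conjI allI impI ballI)
  show "M i j = M j i" if "i \<in> J" "j \<in> J" for i j
    using assms(2,3) that unfolding pos_def_on_def by blast
next
  fix v :: "_ \<Rightarrow> real" assume "\<exists>i\<in>J. v i \<noteq> 0"
  then obtain i where i: "i \<in> J" "v i \<noteq> 0" by blast
  have "quad_form I M (\<lambda>j. if j \<in> J then v j else 0) > 0"
    using i assms(2) by (intro quad_form_pos[OF assms(3), of i]) auto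
  then show "quad_form J M v > 0" by (simp add: quad_form_restrict[OF assms(1,2)])
qed

lemma pos_def_on_id:
  assumes "finite I"
  shows "pos_def_on I (\<lambda>i j. if i = j then 1 else 0)"
  unfolding pos_def_on_def
proof (intro conjI allI impI ballI)
  fix v :: "_ \<Rightarrow> real" assume "\<exists>i\<in>I. v i \<noteq> 0"
  then obtain i where i: "i \<in> I" "v i \<noteq> 0" by blast
  have "quad_form I (\<lambda>i j. if i = j then 1 else 0) v = (\<Sum>i\<in>I. v i * v i)"
  proof -
    have "quad_form I (\<lambda>i j. if i = j then 1 else 0) v = (\<Sum>i\<in>I. \<Sum>j\<in>I. if i = j then v i * v j else 0)"
      unfolding quad_form_def by (intro sum.cong) auto
    then show ?thesis using assms by simp
  qed
  also have "\<dots> > 0"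
    using i assms by (intro sum_pos2[of I i]) (auto simp: zero_less_mult_iff)
  finally show "quad_form I (\<lambda>i j. if i = j then 1 else 0) v > 0" .
qed auto

lemma pos_def_on_convex:
  assumes "pos_def_on I A" "pos_def_on I B" "0 \<le> t" "t \<le> 1"
  shows "pos_def_on I (\<lambda>i j. (1 - t) * A i j + t * B i j)"
  unfolding pos_def_on_def quad_form_lincomb
proof (intro conjI allI impI ballI)
  show "(1 - t) * A i j + t * B i j = (1 - t) * A j i + t * B j i" if "i \<in> I" "j \<in> I" for i j
    using assms(1,2) that by (simp add: pos_def_on_def)
next
  fix v :: "_ \<Rightarrow> real" assume "\<exists>i\<in>I. v i \<noteq> 0"
  then have "quad_form I A v > 0" "quad_form I B v > 0"
    using assms(1,2) by (auto simp: pos_def_on_def)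
  then show "(1 - t) * quad_form I A v + t * quad_form I B v > 0"
    using assms(3,4) by (cases "t = 0") (auto intro: add_nonneg_pos add_pos_nonneg)
qed

section \<open>Inverses and determinants of positive definite matrices\<close>

text \<open>Existence of inverses and facts about determinants are transferred from the
  Jordan_Normal_Form matrices through an enumeration of the index set.\<close>

definition index_enum :: "'i set \<Rightarrow> nat \<Rightarrow> 'i" where
  "index_enum I = (SOME g. bij_betw g {0..<card I} I)"

definition mat_on :: "'i set \<Rightarrow> ('i \<Rightarrow> 'i \<Rightarrow> real) \<Rightarrow> real mat" where
  "mat_on I M = Matrix.mat (card I) (card I) (\<lambda>(a, b). M (index_enum I a) (index_enum I b))"

lemma mat_on_carrier: "mat_on I M \<in> carrier_mat (card I) (card I)"
  by (simp add: mat_on_def)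

lemma index_enum_props:
  assumes "finite I"
  defines "g \<equiv> index_enum I" and "h \<equiv> inv_into {0..<card I} (index_enum I)"
  shows "bij_betw g {0..<card I} I" "bij_betw h I {0..<card I}"
    "\<And>x. x \<in> I \<Longrightarrow> g (h x) = x" "\<And>a. a < card I \<Longrightarrow> h (g a) = a"
    "\<And>x. x \<in> I \<Longrightarrow> h x < card I" "\<And>a. a < card I \<Longrightarrow> g a \<in> I"
    "inj_on g {0..<card I}" "inj_on h I"
proof -
  show g: "bij_betw g {0..<card I} I"
    unfolding g_def index_enum_def by (metis someI_ex ex_bij_betw_nat_finite assms(1))
  show h: "bij_betw h I {0..<card I}"
    unfolding h_def by (rule bij_betw_inv_into[OF g[unfolded g_def]])
  show "\<And>x. x \<in> I \<Longrightarrow> g (h x) = x"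
    unfolding h_def g_def by (rule bij_betw_inv_into_right[OF g[unfolded g_def]])
  show "\<And>a. a < card I \<Longrightarrow> h (g a) = a"
    unfolding h_def g_def by (rule bij_betw_inv_into_left[OF g[unfolded g_def]]) simp
  show "\<And>x. x \<in> I \<Longrightarrow> h x < card I" using bij_betwE[OF h] by simp
  show "\<And>a. a < card I \<Longrightarrow> g a \<in> I" using bij_betwE[OF g] by simp
  show "inj_on g {0..<card I}" using g by (rule bij_betw_imp_inj_on)
  show "inj_on h I" using h by (rule bij_betw_imp_inj_on)
qed

lemma det_on_eq_det:
  assumes "finite I"
  shows "det_on I M = Determinant.det (mat_on I M)"
proof -
  define m g where "m = card I" and "g = index_enum I"
  define h where "h = inv_into {0..<m} g"
  note ef = index_enum_props[OF assms, folded g_def m_def, folded h_def]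
  have "Determinant.det (mat_on I M)
      = (\<Sum>q\<in>{q. q permutes {0..<m}}. signof q * (\<Prod>a=0..<m. M (g a) (g (q a))))"
    unfolding det_def'[OF mat_on_carrier] m_def[symmetric]
    by (intro sum.cong refl prod.cong) (auto simp: mat_on_def m_def g_def permutes_in_image)
  also have "\<dots> = (\<Sum>\<pi>\<in>{\<pi>. \<pi> permutes I}. of_int (sign \<pi>) * (\<Prod>x\<in>I. M x (\<pi> x)))"
  proof (rule sum.reindex_bij_witness[where i = "map_permutation I h" and j = "map_permutation {0..<m} g"])
    fix q assume "q \<in> {q. q permutes {0..<m}}"
    then have q: "q permutes {0..<m}" by simp
    show "map_permutation I h (map_permutation {0..<m} g q) = q"
      by (rule map_permutation_compose_inv[OF ef(1) q]) (use ef(4) in auto)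
    show "map_permutation {0..<m} g q \<in> {\<pi>. \<pi> permutes I}"
      using map_permutation_permutes[OF ef(1) q] by simp
    have "(\<Prod>x\<in>I. M x (map_permutation {0..<m} g q x))
        = (\<Prod>a\<in>{0..<m}. M (g a) (map_permutation {0..<m} g q (g a)))"
      by (rule prod.reindex_bij_betw[OF ef(1), symmetric])
    also have "\<dots> = (\<Prod>a=0..<m. M (g a) (g (q a)))"
      by (intro prod.cong refl) (simp add: map_permutation_apply[OF ef(7)])
    finally show "of_int (sign (map_permutation {0..<m} g q)) * (\<Prod>x\<in>I. M x (map_permutation {0..<m} g q x))
        = signof q * (\<Prod>a=0..<m. M (g a) (g (q a)))"
      using sign_map_permutation[OF ef(7) q] by simp
  next
    fix \<pi> assume "\<pi> \<in> {\<pi>. \<pi> permutes I}"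
    then have p: "\<pi> permutes I" by simp
    show "map_permutation {0..<m} g (map_permutation I h \<pi>) = \<pi>"
      by (rule map_permutation_compose_inv[OF ef(2) p]) (use ef(3) in auto)
    show "map_permutation I h \<pi> \<in> {q. q permutes {0..<m}}"
      using map_permutation_permutes[OF ef(2) p] by simp
  qed
  finally show ?thesis unfolding det_on_def by simp
qed

lemma pos_def_on_det_nonzero:
  assumes "finite I" "pos_def_on I M"
  shows "det_on I M \<noteq> 0"
proof
  assume "det_on I M = 0"
  define m g where "m = card I" and "g = index_enum I"
  define h where "h = inv_into {0..<m} g"
  note ef = index_enum_props[OF assms(1), folded g_def m_def, folded h_def]
  have "Determinant.det (mat_on I M) = 0" using \<open>det_on I M = 0\<close> det_on_eq_det[OF assms(1)] by simp
  then obtain v where v: "v \<in> carrier_vec m" "v \<noteq> 0\<^sub>v m" "mat_on I M *\<^sub>v v = 0\<^sub>v m"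
    using det_0_iff_vec_prod_zero[OF mat_on_carrier[of I M]] m_def by auto
  obtain a where a: "a < m" "Matrix.vec_index v a \<noteq> 0"
    using v(1,2) by (metis carrier_vecD eq_vecI index_zero_vec(1) index_zero_vec(2))
  define w where "w x = Matrix.vec_index v (h x)" for x
  have "mvec I M w x = 0" if x: "x \<in> I" for x
  proof -
    have "mvec I M w x = (\<Sum>b\<in>{0..<m}. M (g (h x)) (g b) * Matrix.vec_index v b)"
      unfolding mvec_def w_def
      by (subst sum.reindex_bij_betw[OF ef(1), symmetric]) (intro sum.cong refl, simp add: ef x)
    also have "\<dots> = Matrix.vec_index (mat_on I M *\<^sub>v v) (h x)"
      using v(1) ef(5)[OF x] by (simp add: mat_on_def m_def g_def scalar_prod_def)
    finally show ?thesis using v(3) ef(5)[OF x] by (simp add: m_def)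
  qed
  then have "quad_form I M w = 0" by (simp add: quad_form_dot_on dot_on_def)
  moreover have "quad_form I M w > 0"
    using a ef(4,6) by (intro quad_form_pos[OF assms(2), of "g a"]) (auto simp: w_def)
  ultimately show False by simp
qed

lemma pos_def_on_rinv_on_exists:
  assumes "finite I" "pos_def_on I M"
  shows "\<exists>N. rinv_on I M N \<and> (\<forall>i j. i \<notin> I \<or> j \<notin> I \<longrightarrow> N i j = 0)"
proof -
  define m g where "m = card I" and "g = index_enum I"
  define h where "h = inv_into {0..<m} g"
  note ef = index_enum_props[OF assms(1), folded g_def m_def, folded h_def]
  have "Determinant.det (mat_on I M) \<noteq> 0"
    using pos_def_on_det_nonzero[OF assms] det_on_eq_det[OF assms(1)] by simp
  from det_non_zero_imp_unit[OF mat_on_carrier this, of "()"]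
  obtain B where B: "B \<in> carrier_mat m m" "mat_on I M * B = 1\<^sub>m m"
    unfolding Units_def ring_mat_def by (auto simp: m_def)
  define N where "N x y = (if x \<in> I \<and> y \<in> I then B $$ (h x, h y) else 0)" for x y
  have "(\<Sum>k\<in>I. M i k * N k j) = (if i = j then 1 else 0)" if i: "i \<in> I" and j: "j \<in> I" for i j
  proof -
    have "(\<Sum>k\<in>I. M i k * N k j) = (\<Sum>c\<in>{0..<m}. mat_on I M $$ (h i, c) * B $$ (c, h j))"
      by (subst sum.reindex_bij_betw[OF ef(1), symmetric])
        (use i j ef in \<open>auto intro!: sum.cong simp: N_def mat_on_def m_def g_def\<close>)
    also have "\<dots> = (mat_on I M * B) $$ (h i, h j)"
      using B(1) ef(5)[OF i] ef(5)[OF j] by (simp add: scalar_prod_def mat_on_def m_def)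
    also have "\<dots> = (1\<^sub>m m :: real mat) $$ (h i, h j)" using B(2) by simp
    also have "\<dots> = (if i = j then 1 else 0)"
      using ef(5)[OF i] ef(5)[OF j] inj_on_eq_iff[OF ef(8) i j] by (simp add: m_def)
    finally show ?thesis .
  qed
  then show ?thesis unfolding rinv_on_def by (intro exI[of _ N]) (auto simp: N_def)
qed

lemma rinv_on_inv_on:
  assumes "finite I" "pos_def_on I M"
  shows "rinv_on I M (inv_on I M)"
  using someI_ex[OF pos_def_on_rinv_on_exists[OF assms, unfolded rinv_on_def]]
  unfolding inv_on_def rinv_on_def by auto

lemma rinv_on_unique:
  assumes "finite I" "rinv_on I A B" "rinv_on I B C" "i \<in> I" "j \<in> I"
  shows "A i j = C i j"
proof -
  have "mvec I B (\<lambda>l. C l j) k = (if k = j then 1 else 0)" if "k \<in> I" for k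
    using assms(3,5) that by (simp add: rinv_on_def mvec_def)
  then have "mvec I A (mvec I B (\<lambda>l. C l j)) i = (\<Sum>k\<in>I. if k = j then A i k else 0)"
    unfolding mvec_def by (intro sum.cong) auto
  also have "\<dots> = A i j" using assms(1,5) by simp
  finally show ?thesis using rinv_on_mvec[OF assms(1,2,4)] by simp
qed

lemma rinv_on_symm:
  assumes "finite I" "symm_on I M" "rinv_on I M N"
  shows "symm_on I N"
proof -
  have "rinv_on I (mtr N) M"
    unfolding rinv_on_def
  proof (intro ballI)
    fix i j assume ij: "i \<in> I" "j \<in> I"
    have "(\<Sum>k\<in>I. mtr N i k * M k j) = (\<Sum>k\<in>I. M j k * N k i)"
      using assms(2) ij by (intro sum.cong) (auto simp: symm_on_def mtr_def)
    also have "\<dots> = (if i = j then 1 else 0)"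
      using assms(3) ij by (auto simp: rinv_on_def)
    finally show "(\<Sum>k\<in>I. mtr N i k * M k j) = (if i = j then 1 else 0)" .
  qed
  from rinv_on_unique[OF assms(1) this assms(3)] show ?thesis
    by (simp add: symm_on_def mtr_def)
qed

lemma inv_on_symm: "finite I \<Longrightarrow> pos_def_on I M \<Longrightarrow> symm_on I (inv_on I M)"
  by (rule rinv_on_symm[OF _ pos_def_on_symm rinv_on_inv_on])

lemma inv_on_pos_def:
  assumes "finite I" "pos_def_on I M"
  shows "pos_def_on I (inv_on I M)"
  unfolding pos_def_on_def
proof (intro conjI allI impI ballI)
  show "inv_on I M i j = inv_on I M j i" if "i \<in> I" "j \<in> I" for i j
    using inv_on_symm[OF assms] that by (simp add: symm_on_def)
next
  fix v :: "_ \<Rightarrow> real" assume "\<exists>i\<in>I. v i \<noteq> 0"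
  then obtain i where i: "i \<in> I" "v i \<noteq> 0" by blast
  define y where "y = mvec I (inv_on I M) v"
  have My: "mvec I M y k = v k" if "k \<in> I" for k
    unfolding y_def by (rule rinv_on_mvec[OF assms(1) rinv_on_inv_on[OF assms] that])
  have "\<exists>k\<in>I. y k \<noteq> 0"
  proof (rule ccontr)
    assume "\<not> (\<exists>k\<in>I. y k \<noteq> 0)"
    then have "mvec I M y i = 0" unfolding mvec_def by (intro sum.neutral) auto
    then show False using My[OF i(1)] i(2) by simp
  qed
  then obtain k where k: "k \<in> I" "y k \<noteq> 0" by blast
  have "quad_form I (inv_on I M) v = dot_on I v y" by (simp add: quad_form_dot_on y_def)
  also have "\<dots> = dot_on I (mvec I M y) y" by (rule dot_on_cong) (auto simp: My)
  also have "\<dots> = quad_form I M y" by (simp add: quad_form_dot_on dot_on_commute)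
  also have "\<dots> > 0" by (rule quad_form_pos[where v = y, OF assms(2) k])
  finally show "quad_form I (inv_on I M) v > 0" .
qed

lemma inv_on_inv_on:
  assumes "finite I" "pos_def_on I M" "i \<in> I" "j \<in> I"
  shows "inv_on I (inv_on I M) i j = M i j"
  using rinv_on_unique[OF assms(1) rinv_on_inv_on[OF assms(1,2)]
      rinv_on_inv_on[OF assms(1) inv_on_pos_def[OF assms(1,2)]] assms(3,4)]
  by simp

lemma det_on_id:
  assumes "finite I"
  shows "det_on I (\<lambda>i j. if i = j then 1 else 0) = 1"
proof -
  define g where "g = index_enum I"
  note ef = index_enum_props[OF assms, folded g_def]
  have "mat_on I (\<lambda>i j. if i = j then 1 else 0) = 1\<^sub>m (card I)"
    by (rule eq_matI) (use inj_on_eq_iff[OF ef(7)] in \<open>auto simp: mat_on_def g_def\<close>)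
  then show ?thesis by (simp add: det_on_eq_det[OF assms])
qed

text \<open>Along the segment from the identity to \<open>M\<close> the matrix stays positive definite, so its
  continuous determinant never vanishes and keeps the sign it has at the identity.\<close>

lemma det_on_pos:
  assumes "finite I" "pos_def_on I M"
  shows "det_on I M > 0"
proof (rule ccontr)
  define Mt where "Mt t = (\<lambda>i j. (1 - t) * (if i = j then 1 else 0) + t * M i j)" for t :: real
  assume "\<not> det_on I M > 0"
  moreover have "Mt 1 = M" by (simp add: Mt_def)
  moreover have "det_on I (Mt 0) = 1"
    using det_on_id[OF assms(1)] by (simp add: Mt_def)
  moreover have "continuous_on {0..1} (\<lambda>t. det_on I (Mt t))"
    unfolding det_on_def Mt_def by (intro continuous_intros)
  ultimately obtain t where "0 \<le> t" "t \<le> 1" "det_on I (Mt t) = 0"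
    using IVT2'[of "\<lambda>t. det_on I (Mt t)" 1 0 0] by auto
  then show False
    using pos_def_on_det_nonzero[OF assms(1) pos_def_on_convex[OF pos_def_on_id[OF assms(1)] assms(2)]]
    by (simp add: Mt_def)
qed

lemma gauss_density_exp:
  assumes "finite I" "pos_def_on I \<Sigma>"
  obtains N where "N > 0"
    "\<And>\<mu> x. gauss_density I \<mu> \<Sigma> x = exp (- quad_form I (inv_on I \<Sigma>) (\<lambda>i. x i - \<mu> i) / 2) / N"
proof
  show "sqrt ((2 * pi) ^ card I * det_on I \<Sigma>) > 0"
    using det_on_pos[OF assms] by simp
qed (simp add: gauss_density_def)

lemma gauss_density_pos:
  assumes "finite I" "pos_def_on I \<Sigma>"
  shows "gauss_density I \<mu> \<Sigma> x > 0"
  using det_on_pos[OF assms] by (simp add: gauss_density_def)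

section \<open>Completing the square\<close>

lemma dot_on_congruence:
  "dot_on P (mvec D Q x) (mvec P S (mvec D Q z)) = dot_on D x (mvec D (mmul P (mtr Q) (mmul P S Q)) z)"
  by (simp add: mvec_mmul dot_on_mvec_mtr[of D x])

lemma symm_on_congruence:
  assumes "symm_on P S"
  shows "symm_on D (mmul P (mtr Q) (mmul P S Q))"
  unfolding symm_on_def
proof (intro ballI)
  have entry: "mmul P (mtr Q) (mmul P S Q) i j = dot_on P (\<lambda>a. Q a i) (mvec P S (\<lambda>b. Q b j))" for i j
    by (simp add: mmul_def mtr_def dot_on_def mvec_def)
  show "mmul P (mtr Q) (mmul P S Q) i j = mmul P (mtr Q) (mmul P S Q) j i" for i j
    unfolding entry by (rule dot_on_mvec_symm[OF assms])
qed

lemma pos_def_on_congruence: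
  assumes "pos_def_on P S" and inj: "\<And>x. (\<forall>i\<in>P. mvec D Q x i = 0) \<Longrightarrow> \<forall>d\<in>D. x d = 0"
  shows "pos_def_on D (mmul P (mtr Q) (mmul P S Q))"
  unfolding pos_def_on_def
proof (intro conjI allI impI)
  show "\<forall>i\<in>D. \<forall>j\<in>D. mmul P (mtr Q) (mmul P S Q) i j = mmul P (mtr Q) (mmul P S Q) j i"
    using symm_on_congruence[OF pos_def_on_symm[OF assms(1)]] by (simp add: symm_on_def)
next
  fix x :: "_ \<Rightarrow> real" assume "\<exists>i\<in>D. x i \<noteq> 0"
  then obtain i where "i \<in> P" "mvec D Q x i \<noteq> 0" using inj by blast
  then have "quad_form P S (mvec D Q x) > 0" by (rule quad_form_pos[OF assms(1)])
  then show "quad_form D (mmul P (mtr Q) (mmul P S Q)) x > 0"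
    by (simp add: quad_form_dot_on flip: dot_on_congruence)
qed

text \<open>In the locale, \<open>S\<close> stands for \<open>\<Sigma>\<^sub>\<Omega>\<^sup>-\<^sup>1\<close>, \<open>G = Q2\<^sup>T S Q2 = \<Gamma>\<^sup>-\<^sup>1\<close> and \<open>H = \<Theta>\<^sup>-\<^sup>1\<close>;
  \<open>Q2 (proj w)\<close> is the \<open>S\<close>-orthogonal projection of \<open>w\<close> onto the range of \<open>Q2\<close>.\<close>

locale gaussian_conditioning =
  fixes E :: "'e set" and D :: "'d set" and P :: "'p set"
    and Q1 :: "'p \<Rightarrow> 'e \<Rightarrow> real" and Q2 :: "'p \<Rightarrow> 'd \<Rightarrow> real"
    and S :: "'p \<Rightarrow> 'p \<Rightarrow> real" and Info :: "'e \<Rightarrow> 'e \<Rightarrow> real"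
  assumes finite_E: "finite E" and finite_D: "finite D" and finite_P: "finite P"
    and S_pos_def: "pos_def_on P S" and Info_pos_def: "pos_def_on E Info"
    and Q2_injective: "\<And>x. (\<forall>i\<in>P. mvec D Q2 x i = 0) \<Longrightarrow> \<forall>d\<in>D. x d = 0"
begin

definition G :: "'d \<Rightarrow> 'd \<Rightarrow> real" where
  "G = mmul P (mtr Q2) (mmul P S Q2)"

definition Gam :: "'d \<Rightarrow> 'd \<Rightarrow> real" where
  "Gam = inv_on D G"

definition Psi :: "'d \<Rightarrow> 'e \<Rightarrow> real" where
  "Psi = mmul D Gam (mmul P (mtr Q2) (mmul P S Q1))"

definition H :: "'e \<Rightarrow> 'e \<Rightarrow> real" where
  "H = (\<lambda>a b. Info a b + mmul P (mtr Q1) (mmul P S Q1) a b - mmul D (mtr Psi) (mmul D (inv_on D Gam) Psi) a b)"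

definition Theta :: "'e \<Rightarrow> 'e \<Rightarrow> real" where
  "Theta = inv_on E H"

definition proj :: "('p \<Rightarrow> real) \<Rightarrow> 'd \<Rightarrow> real" where
  "proj w = mvec D Gam (mvec P (mtr Q2) (mvec P S w))"

definition residual :: "('p \<Rightarrow> real) \<Rightarrow> 'p \<Rightarrow> real" where
  "residual w = (\<lambda>i. w i - mvec D Q2 (proj w) i)"

definition tau :: "('p \<Rightarrow> real) \<Rightarrow> 'd \<Rightarrow> real" where
  "tau r = (\<lambda>d. - proj r d)"

definition kappa :: "('p \<Rightarrow> real) \<Rightarrow> 'e \<Rightarrow> real" where
  "kappa r = mvec E Theta (\<lambda>a. mvec D (mtr Psi) (mvec D (inv_on D Gam) (tau r)) a + mvec P (mtr Q1) (mvec P S r) a)"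

lemma S_symm: "symm_on P S"
  by (rule pos_def_on_symm[OF S_pos_def])

lemma G_pos_def: "pos_def_on D G"
  unfolding G_def by (rule pos_def_on_congruence[OF S_pos_def Q2_injective])

lemma G_symm: "symm_on D G"
  by (rule pos_def_on_symm[OF G_pos_def])

lemma Gam_pos_def: "pos_def_on D Gam"
  unfolding Gam_def by (rule inv_on_pos_def[OF finite_D G_pos_def])

lemma inv_on_Gam: "i \<in> D \<Longrightarrow> j \<in> D \<Longrightarrow> inv_on D Gam i j = G i j"
  unfolding Gam_def by (rule inv_on_inv_on[OF finite_D G_pos_def])

lemma G_proj: "d \<in> D \<Longrightarrow> mvec D G (proj w) d = mvec P (mtr Q2) (mvec P S w) d"
  unfolding proj_def Gam_def by (rule rinv_on_mvec[OF finite_D rinv_on_inv_on[OF finite_D G_pos_def]])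

lemma Psi_eq_proj: "mvec E Psi x = proj (mvec E Q1 x)"
  by (simp add: Psi_def proj_def mvec_mmul)

lemma proj_diff: "proj (\<lambda>i. x i - y i) = (\<lambda>d. proj x d - proj y d)"
  by (simp add: proj_def mvec_diff)

lemma residual_diff: "residual (\<lambda>i. x i - y i) = (\<lambda>i. residual x i - residual y i)"
  by (simp add: residual_def proj_diff mvec_diff algebra_simps)

lemma dot_on_range: "dot_on P w (mvec P S (mvec D Q2 z)) = dot_on D (proj w) (mvec D G z)"
proof -
  have "dot_on P w (mvec P S (mvec D Q2 z)) = dot_on D z (mvec P (mtr Q2) (mvec P S w))"
    unfolding dot_on_mvec_mtr[of D z] mtr_mtr by (rule dot_on_mvec_symm[OF S_symm])
  also have "\<dots> = dot_on D z (mvec D G (proj w))"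
    by (rule dot_on_cong) (simp_all add: G_proj)
  finally show ?thesis by (simp add: dot_on_mvec_symm[OF G_symm, of z])
qed

lemma residual_orthogonal: "dot_on P (residual w) (mvec P S (mvec D Q2 z)) = 0"
  by (simp add: residual_def dot_on_diff_left dot_on_range dot_on_congruence flip: G_def)

lemma dot_on_residual:
  "dot_on P (residual a) (mvec P S (residual c))
    = dot_on P a (mvec P S c) - dot_on D (proj a) (mvec D G (proj c))"
proof -
  have "dot_on P (residual a) (mvec P S (residual c)) = dot_on P (residual a) (mvec P S c)"
    by (simp add: residual_def[of c] mvec_diff dot_on_diff_right residual_orthogonal)
  also have "\<dots> = dot_on P c (mvec P S (residual a))"
    by (rule dot_on_mvec_symm[OF S_symm])
  also have "\<dots> = dot_on P a (mvec P S c) - dot_on D (proj c) (mvec D G (proj a))"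
    by (simp add: residual_def[of a] mvec_diff dot_on_diff_right dot_on_range dot_on_mvec_symm[OF S_symm, of c])
  finally show ?thesis by (simp add: dot_on_mvec_symm[OF G_symm, of "proj c"])
qed

lemma dot_on_H:
  "dot_on E x (mvec E H z)
    = dot_on E x (mvec E Info z) + dot_on P (residual (mvec E Q1 x)) (mvec P S (residual (mvec E Q1 z)))"
proof -
  have "dot_on E x (mvec E (mmul D (mtr Psi) (mmul D (inv_on D Gam) Psi)) z)
      = dot_on D (mvec E Psi x) (mvec D (inv_on D Gam) (mvec E Psi z))"
    by (simp add: mvec_mmul dot_on_mvec_mtr[of E x])
  also have "\<dots> = dot_on D (proj (mvec E Q1 x)) (mvec D G (proj (mvec E Q1 z)))"
    unfolding Psi_eq_proj by (intro dot_on_cong refl mvec_cong) (simp_all add: inv_on_Gam)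
  finally show ?thesis
    unfolding dot_on_residual H_def mvec_mat_add_diff dot_on_add_right dot_on_diff_right
    by (simp add: mvec_mmul dot_on_mvec_mtr[of E x])
qed

lemma H_symm: "symm_on E H"
  using pos_def_on_symm[OF Info_pos_def] symm_on_congruence[OF S_symm, where D = E and Q = Q1]
    symm_on_congruence[OF inv_on_symm[OF finite_D Gam_pos_def], where D = E and Q = Psi]
  unfolding H_def symm_on_def by simp

lemma H_pos_def: "pos_def_on E H"
  unfolding pos_def_on_def
proof (intro conjI allI impI)
  show "\<forall>i\<in>E. \<forall>j\<in>E. H i j = H j i" using H_symm by (simp add: symm_on_def)
next
  fix x :: "'e \<Rightarrow> real" assume "\<exists>i\<in>E. x i \<noteq> 0"
  then have "quad_form E Info x > 0" using Info_pos_def by (auto simp: pos_def_on_def)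
  moreover have "quad_form P S (residual (mvec E Q1 x)) \<ge> 0" by (rule quad_form_nonneg[OF S_pos_def])
  ultimately show "quad_form E H x > 0" by (simp add: quad_form_dot_on dot_on_H)
qed

lemma Theta_pos_def: "pos_def_on E Theta"
  unfolding Theta_def by (rule inv_on_pos_def[OF finite_E H_pos_def])

lemma inv_on_Theta: "i \<in> E \<Longrightarrow> j \<in> E \<Longrightarrow> inv_on E Theta i j = H i j"
  unfolding Theta_def by (rule inv_on_inv_on[OF finite_E H_pos_def])

lemma quad_form_residual_add:
  "quad_form P S (\<lambda>i. residual w i + mvec D Q2 z i) = quad_form P S (residual w) + quad_form D G z"
  unfolding quad_form_add[OF S_symm] residual_orthogonal
  by (simp add: quad_form_dot_on dot_on_congruence flip: G_def)

lemma dot_on_kappa_source: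
  "dot_on E b (\<lambda>a. mvec D (mtr Psi) (mvec D (inv_on D Gam) (tau r)) a + mvec P (mtr Q1) (mvec P S r) a)
    = dot_on P (residual (mvec E Q1 b)) (mvec P S (residual r))"
proof -
  have "dot_on E b (\<lambda>a. mvec D (mtr Psi) (mvec D (inv_on D Gam) (tau r)) a + mvec P (mtr Q1) (mvec P S r) a)
      = dot_on D (mvec E Psi b) (mvec D (inv_on D Gam) (tau r)) + dot_on P (mvec E Q1 b) (mvec P S r)"
    by (simp add: dot_on_add_right dot_on_mvec_mtr[of E b])
  also have "\<dots> = dot_on P (mvec E Q1 b) (mvec P S r) - dot_on D (proj (mvec E Q1 b)) (mvec D G (proj r))"
    unfolding Psi_eq_proj tau_def mvec_minus
    by (simp add: inv_on_Gam dot_on_minus_right cong: dot_on_cong mvec_cong)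
  finally show ?thesis by (simp add: dot_on_residual)
qed

lemma exponent_decomposition:
  obtains c where "\<And>b B. quad_form E Info (\<lambda>i. b i - mu i)
        + quad_form P S (\<lambda>i. - mvec E Q1 b i + mvec D Q2 B i + r i)
      = quad_form E H (\<lambda>i. b i - (mvec E (mmul E Theta Info) mu i + kappa r i))
        + quad_form D G (\<lambda>d. B d - (mvec E Psi b d + tau r d)) + c"
proof
  define Y where "Y = (\<lambda>a. mvec D (mtr Psi) (mvec D (inv_on D Gam) (tau r)) a + mvec P (mtr Q1) (mvec P S r) a)"
  define m where "m = (\<lambda>i. mvec E (mmul E Theta Info) mu i + kappa r i)"
  have "m = mvec E Theta (\<lambda>a. mvec E Info mu a + Y a)"
    by (simp add: m_def kappa_def Y_def mvec_add mvec_mmul)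
  then have H_m: "mvec E H m a = mvec E Info mu a + Y a" if "a \<in> E" for a
    using rinv_on_mvec[OF finite_E rinv_on_inv_on[OF finite_E H_pos_def] that] by (simp add: Theta_def)
  have dot_Y: "dot_on E b Y = dot_on P (residual (mvec E Q1 b)) (mvec P S (residual r))" for b
    unfolding Y_def by (rule dot_on_kappa_source)
  define c where "c = quad_form E Info mu + quad_form P S (residual r) - quad_form E H m"
  fix b B
  define z where "z = (\<lambda>d. B d - (mvec E Psi b d + tau r d))"
  have "(\<lambda>i. - mvec E Q1 b i + mvec D Q2 B i + r i) = (\<lambda>i. residual (\<lambda>i. r i - mvec E Q1 b i) i + mvec D Q2 z i)"
    by (simp add: z_def residual_def proj_diff Psi_eq_proj tau_def mvec_diff mvec_add algebra_simps)
  then have "quad_form P S (\<lambda>i. - mvec E Q1 b i + mvec D Q2 B i + r i)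
      = quad_form P S (residual (\<lambda>i. r i - mvec E Q1 b i)) + quad_form D G z"
    by (simp only: quad_form_residual_add)
  also have "quad_form P S (residual (\<lambda>i. r i - mvec E Q1 b i))
      = quad_form P S (residual r) - 2 * dot_on E b Y + quad_form P S (residual (mvec E Q1 b))"
    unfolding residual_diff quad_form_diff[OF S_symm] dot_Y dot_on_mvec_symm[OF S_symm, of "residual r"] ..
  finally have "quad_form P S (\<lambda>i. - mvec E Q1 b i + mvec D Q2 B i + r i)
      = quad_form P S (residual r) - 2 * dot_on E b Y + quad_form P S (residual (mvec E Q1 b)) + quad_form D G z" .
  moreover have "(\<lambda>i. b i - (mvec E (mmul E Theta Info) mu i + kappa r i)) = (\<lambda>i. b i - m i)"
    by (simp add: m_def)
  moreover have "quad_form E H (\<lambda>i. b i - m i)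
      = quad_form E Info b + quad_form P S (residual (mvec E Q1 b)) - 2 * (dot_on E b (mvec E Info mu) + dot_on E b Y) + quad_form E H m"
    by (simp add: quad_form_diff[OF H_symm] quad_form_dot_on[of E H b] dot_on_H quad_form_dot_on[of E Info b]
        quad_form_dot_on[of P S "residual (mvec E Q1 b)"] H_m dot_on_add_right[symmetric] cong: dot_on_cong)
  ultimately show "quad_form E Info (\<lambda>i. b i - mu i)
        + quad_form P S (\<lambda>i. - mvec E Q1 b i + mvec D Q2 B i + r i)
      = quad_form E H (\<lambda>i. b i - (mvec E (mmul E Theta Info) mu i + kappa r i))
        + quad_form D G (\<lambda>d. B d - (mvec E Psi b d + tau r d)) + c"
    by (simp add: quad_form_diff[OF pos_def_on_symm[OF Info_pos_def]] c_def z_def[symmetric])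
qed

lemma gauss_density_factorization:
  assumes "pos_def_on P \<Sigma>" "S = inv_on P \<Sigma>"
  obtains C where "C > 0"
    "\<And>b B. gauss_density E mu (inv_on E Info) b
        * gauss_density P (\<lambda>_. 0) \<Sigma> (\<lambda>i. - mvec E Q1 b i + mvec D Q2 B i + r i)
      = C * gauss_density E (\<lambda>a. mvec E (mmul E Theta Info) mu a + kappa r a) Theta b
          * gauss_density D (\<lambda>d. mvec E Psi b d + tau r d) Gam B"
proof -
  obtain N1 where N1: "N1 > 0" "\<And>\<mu> x. gauss_density E \<mu> (inv_on E Info) x
      = exp (- quad_form E (inv_on E (inv_on E Info)) (\<lambda>i. x i - \<mu> i) / 2) / N1"
    by (rule gauss_density_exp[OF finite_E inv_on_pos_def[OF finite_E Info_pos_def]]) blast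
  obtain N2 where N2: "N2 > 0" "\<And>\<mu> x. gauss_density P \<mu> \<Sigma> x
      = exp (- quad_form P (inv_on P \<Sigma>) (\<lambda>i. x i - \<mu> i) / 2) / N2"
    by (rule gauss_density_exp[OF finite_P assms(1)]) blast
  obtain N3 where N3: "N3 > 0" "\<And>\<mu> x. gauss_density E \<mu> Theta x
      = exp (- quad_form E (inv_on E Theta) (\<lambda>i. x i - \<mu> i) / 2) / N3"
    by (rule gauss_density_exp[OF finite_E Theta_pos_def]) blast
  obtain N4 where N4: "N4 > 0" "\<And>\<mu> x. gauss_density D \<mu> Gam x
      = exp (- quad_form D (inv_on D Gam) (\<lambda>i. x i - \<mu> i) / 2) / N4"
    by (rule gauss_density_exp[OF finite_D Gam_pos_def]) blast
  have forms: "quad_form E (inv_on E (inv_on E Info)) v = quad_form E Info v"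
    "quad_form E (inv_on E Theta) v = quad_form E H v"
    "quad_form D (inv_on D Gam) w = quad_form D G w" for v w
    by (auto intro: quad_form_cong simp: inv_on_inv_on[OF finite_E Info_pos_def] inv_on_Theta inv_on_Gam)
  obtain c where c: "\<And>b B. quad_form E Info (\<lambda>i. b i - mu i)
        + quad_form P S (\<lambda>i. - mvec E Q1 b i + mvec D Q2 B i + r i)
      = quad_form E H (\<lambda>i. b i - (mvec E (mmul E Theta Info) mu i + kappa r i))
        + quad_form D G (\<lambda>d. B d - (mvec E Psi b d + tau r d)) + c"
    by (rule exponent_decomposition[of mu r]) blast
  show ?thesis
  proof
    show "exp (- c / 2) * N3 * N4 / (N1 * N2) > 0" using N1 N2 N3 N4 by simp
    fix b B
    have "exp (- quad_form E Info (\<lambda>i. b i - mu i) / 2)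
          * exp (- quad_form P S (\<lambda>i. - mvec E Q1 b i + mvec D Q2 B i + r i) / 2)
        = exp (- c / 2) * exp (- quad_form E H (\<lambda>i. b i - (mvec E (mmul E Theta Info) mu i + kappa r i)) / 2)
          * exp (- quad_form D G (\<lambda>d. B d - (mvec E Psi b d + tau r d)) / 2)"
      unfolding exp_add[symmetric] using c[of b B] by (simp add: field_simps)
    then show "gauss_density E mu (inv_on E Info) b
        * gauss_density P (\<lambda>_. 0) \<Sigma> (\<lambda>i. - mvec E Q1 b i + mvec D Q2 B i + r i)
      = exp (- c / 2) * N3 * N4 / (N1 * N2)
          * gauss_density E (\<lambda>a. mvec E (mmul E Theta Info) mu a + kappa r a) Theta b
          * gauss_density D (\<lambda>d. mvec E Psi b d + tau r d) Gam B"
      using N1 N2 N3 N4 by (simp add: forms flip: assms(2))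
  qed
qed

end

section \<open>The distributed selective likelihood\<close>

lemma schur_pos_def:
  assumes "finite J" "E \<subseteq> J" "pos_def_on J Info"
  shows "pos_def_on (J - E) (schur E Info)"
proof -
  define F T where "F = J - E" and "T = inv_on E Info"
  have finite_E: "finite E" using assms(1,2) finite_subset by blast
  have Info_E: "pos_def_on E Info" by (rule pos_def_on_subset[OF assms])
  have Info_symm: "symm_on J Info" by (rule pos_def_on_symm[OF assms(3)])
  have schur_eq: "schur E Info i j = Info i j - mmul E (mtr Info) (mmul E T Info) i j" if "i \<in> J" for i j
    using Info_symm that assms(2)
    by (auto simp: schur_def mmul_def mtr_def T_def sum_distrib_left mult.assoc symm_on_def intro!: sum.cong)
  have congr_symm: "symm_on F (mmul E (mtr Info) (mmul E T Info))"
    unfolding T_def by (rule symm_on_congruence[OF inv_on_symm[OF finite_E Info_E]])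
  have schur_form: "quad_form F (schur E Info) v = quad_form F Info v - quad_form E T (mvec F Info v)" for v
  proof -
    have "quad_form F (schur E Info) v = quad_form F (\<lambda>i j. Info i j - mmul E (mtr Info) (mmul E T Info) i j) v"
      by (rule quad_form_cong) (auto simp: schur_eq F_def)
    then show ?thesis
      by (simp add: quad_form_dot_on mvec_mat_diff dot_on_diff_right dot_on_congruence)
  qed
  show ?thesis
    unfolding F_def[symmetric] pos_def_on_def
  proof (intro conjI allI impI ballI)
    show "schur E Info i j = schur E Info j i" if "i \<in> F" "j \<in> F" for i j
      using that Info_symm congr_symm by (simp add: schur_eq F_def symm_on_def)
  next
    fix v :: "nat \<Rightarrow> real" assume "\<exists>i\<in>F. v i \<noteq> 0"
    then obtain f0 where f0: "f0 \<in> F" "v f0 \<noteq> 0" by blast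
    define y z where "y = mvec F Info v" and "z = mvec E T y"
    define w where "w i = (if i \<in> E then - z i else 0) + (if i \<in> F then v i else 0)" for i
    have EF: "E \<subseteq> J" "F \<subseteq> J" using assms(2) by (auto simp: F_def)
    have Info_z: "mvec E Info z a = y a" if "a \<in> E" for a
      unfolding z_def T_def by (rule rinv_on_mvec[OF finite_E rinv_on_inv_on[OF finite_E Info_E] that])
    have "quad_form J Info w = quad_form E Info z - 2 * dot_on E z y + quad_form F Info v"
      unfolding w_def quad_form_add[OF Info_symm]
      by (simp add: quad_form_restrict[OF assms(1) EF(1)] quad_form_restrict[OF assms(1) EF(2)]
          dot_on_restrict[OF assms(1) EF(1)] mvec_restrict[OF assms(1) EF(2)] quad_form_minus
          dot_on_minus_left flip: y_def)
    moreover have "quad_form E Info z = dot_on E z y"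
      unfolding quad_form_dot_on by (rule dot_on_cong) (simp_all add: Info_z)
    moreover have "dot_on E z y = quad_form E T y"
      unfolding quad_form_dot_on z_def[symmetric] by (rule dot_on_commute)
    moreover have "quad_form F (schur E Info) v = quad_form F Info v - quad_form E T y"
      unfolding y_def by (rule schur_form)
    ultimately have "quad_form J Info w = quad_form F (schur E Info) v" by simp
    moreover have "quad_form J Info w > 0"
      using f0 by (intro quad_form_pos[OF assms(3), of f0]) (auto simp: w_def F_def)
    ultimately show "quad_form F (schur E Info) v > 0" by simp
  qed
qed

lemma SigmaOmega_quad_form:
  "quad_form (PKset K p) (SigmaOmega \<rho> Info) v
    = (\<Sum>k\<in>{1..K}. quad_form {..<p} Info (\<lambda>j. v (k, j)) / \<rho> k)
      - quad_form {..<p} Info (\<lambda>j. \<Sum>k\<in>{1..K}. v (k, j))"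
proof -
  define J Ks where "J = {..<p}" and "Ks = {1..K}"
  define b where "b k k' = dot_on J (\<lambda>j. v (k, j)) (mvec J Info (\<lambda>j. v (k', j)))" for k k'
  have "quad_form (PKset K p) (SigmaOmega \<rho> Info) v
      = (\<Sum>k\<in>Ks. \<Sum>j\<in>J. \<Sum>k'\<in>Ks. \<Sum>j'\<in>J. v (k, j) * SigmaOmega \<rho> Info (k, j) (k', j') * v (k', j'))"
    by (simp only: quad_form_def PKset_def Ks_def[symmetric] J_def[symmetric] sum.cartesian_product')
  also have "\<dots> = (\<Sum>k\<in>Ks. \<Sum>k'\<in>Ks. ((if k = k' then 1 / \<rho> k else 0) - 1) * b k k')"
    unfolding b_def dot_on_def mvec_def SigmaOmega_def
    by (subst sum.swap) (simp add: sum_distrib_left mult_ac)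
  also have "\<dots> = (\<Sum>k\<in>Ks. b k k / \<rho> k) - (\<Sum>k\<in>Ks. \<Sum>k'\<in>Ks. b k k')"
    by (simp add: left_diff_distrib sum_subtractf if_distrib[of "\<lambda>x. x * _"] Ks_def cong: if_cong)
  also have "(\<Sum>k\<in>Ks. \<Sum>k'\<in>Ks. b k k') = quad_form J Info (\<lambda>j. \<Sum>k\<in>Ks. v (k, j))"
    unfolding b_def quad_form_dot_on dot_on_sum_left mvec_sum dot_on_sum_right ..
  finally show ?thesis by (simp add: b_def J_def Ks_def quad_form_dot_on)
qed

text \<open>Completing the square around \<open>v\<^sub>k = \<rho>\<^sub>k s\<close>, \<open>s = \<Sum>\<^sub>k v\<^sub>k\<close>, leaves the remainder
  \<open>(1 - \<Sum>\<^sub>k \<rho>\<^sub>k) s\<^sup>T \<I> s\<close>, which is positive because machine \<open>0\<close> holds data.\<close>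

lemma SigmaOmega_pos_def:
  assumes Info: "pos_def_on {..<p} Info"
    and \<rho>_pos: "\<forall>k\<in>{1..K}. \<rho> k > 0" and \<rho>_sum: "(\<Sum>k\<in>{1..K}. \<rho> k) < 1"
  shows "pos_def_on (PKset K p) (SigmaOmega \<rho> Info)"
  unfolding pos_def_on_def
proof (intro conjI allI impI ballI)
  show "SigmaOmega \<rho> Info a b = SigmaOmega \<rho> Info b a" if "a \<in> PKset K p" "b \<in> PKset K p" for a b
    using that Info by (auto simp: SigmaOmega_def PKset_def pos_def_on_def split: prod.splits)
next
  define J Ks where "J = {..<p}" and "Ks = {1..K}"
  define q where "q x = quad_form J Info x" for x
  fix v :: "nat \<times> nat \<Rightarrow> real"
  define s where "s = (\<lambda>j. \<Sum>k\<in>Ks. v (k, j))"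
  define t where "t k = (\<lambda>j. v (k, j) - \<rho> k * s j)" for k
  have \<rho>_pos': "\<rho> k > 0" if "k \<in> Ks" for k using \<rho>_pos that by (simp add: Ks_def)
  have q_nonneg: "q x \<ge> 0" for x unfolding q_def J_def by (rule quad_form_nonneg[OF Info])
  have Info_symm: "symm_on J Info" unfolding J_def by (rule pos_def_on_symm[OF Info])
  have "q (t k) / \<rho> k = q (\<lambda>j. v (k, j)) / \<rho> k - 2 * dot_on J (\<lambda>j. v (k, j)) (mvec J Info s) + \<rho> k * q s"
    if "k \<in> Ks" for k
  proof -
    from \<rho>_pos'[OF that] show ?thesis
      by (simp add: t_def q_def quad_form_diff[OF Info_symm] mvec_scale dot_on_scale_right quad_form_scale
          field_simps)
  qed
  then have "(\<Sum>k\<in>Ks. q (t k) / \<rho> k) = (\<Sum>k\<in>Ks. q (\<lambda>j. v (k, j)) / \<rho> k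
      - 2 * dot_on J (\<lambda>j. v (k, j)) (mvec J Info s) + \<rho> k * q s)"
    by (rule sum.cong[OF refl])
  also have "\<dots> = (\<Sum>k\<in>Ks. q (\<lambda>j. v (k, j)) / \<rho> k) - 2 * q s + (\<Sum>k\<in>Ks. \<rho> k) * q s"
    unfolding sum.distrib sum_subtractf sum_distrib_left[symmetric] sum_distrib_right[symmetric]
      dot_on_sum_left[symmetric] q_def quad_form_dot_on s_def ..
  finally have "(\<Sum>k\<in>Ks. q (t k) / \<rho> k)
      = (\<Sum>k\<in>Ks. q (\<lambda>j. v (k, j)) / \<rho> k) - 2 * q s + (\<Sum>k\<in>Ks. \<rho> k) * q s" .
  then have form: "quad_form (PKset K p) (SigmaOmega \<rho> Info) v
      = (\<Sum>k\<in>Ks. q (t k) / \<rho> k) + (1 - (\<Sum>k\<in>Ks. \<rho> k)) * q s"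
    unfolding SigmaOmega_quad_form by (simp add: q_def s_def J_def Ks_def algebra_simps)
  have terms_nonneg: "q (t k) / \<rho> k \<ge> 0" if "k \<in> Ks" for k
    using \<rho>_pos'[OF that] q_nonneg[of "t k"] by simp
  assume "\<exists>i\<in>PKset K p. v i \<noteq> 0"
  then obtain k0 j0 where k0: "k0 \<in> Ks" "j0 \<in> J" "v (k0, j0) \<noteq> 0"
    by (auto simp: PKset_def Ks_def J_def)
  show "quad_form (PKset K p) (SigmaOmega \<rho> Info) v > 0"
  proof (cases "\<exists>j\<in>J. s j \<noteq> 0")
    case True
    then obtain j where j: "j < p" "s j \<noteq> 0" by (auto simp: J_def)
    have "q s > 0" unfolding q_def J_def by (rule quad_form_pos[where v = s, OF Info _ j(2)]) (simp add: j(1))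
    then have "(1 - (\<Sum>k\<in>Ks. \<rho> k)) * q s > 0" using \<rho>_sum by (simp add: Ks_def)
    moreover have "(\<Sum>k\<in>Ks. q (t k) / \<rho> k) \<ge> 0" by (rule sum_nonneg[OF terms_nonneg])
    ultimately show ?thesis unfolding form by linarith
  next
    case False
    then have "q (t k0) = q (\<lambda>j. v (k0, j))"
      unfolding q_def t_def by (intro quad_form_cong) simp_all
    also have "\<dots> > 0"
      unfolding q_def J_def by (rule quad_form_pos[where v = "\<lambda>j. v (k0, j)", OF Info _ k0(3)]) (use k0(2) J_def in simp)
    finally have pos0: "q (t k0) / \<rho> k0 > 0" using \<rho>_pos'[OF k0(1)] by simp
    have "(\<Sum>k\<in>Ks. q (t k) / \<rho> k) > 0"
      by (rule sum_pos2[where f = "\<lambda>k. q (t k) / \<rho> k", OF _ k0(1) pos0 terms_nonneg]) (simp add: Ks_def)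
    moreover have "(1 - (\<Sum>k\<in>Ks. \<rho> k)) * q s \<ge> 0" using \<rho>_sum q_nonneg[of s] by (simp add: Ks_def)
    ultimately show ?thesis unfolding form by linarith
  qed
qed

lemma mvec_Q2:
  assumes "finite Ks" "\<forall>k\<in>Ks. finite (Ek k)" "k \<in> Ks"
  shows "mvec (Sigma Ks Ek) (Q2 Info) x (k, j) = mvec (Ek k) Info (\<lambda>e. x (k, e)) j"
proof -
  have "mvec (Sigma Ks Ek) (Q2 Info) x (k, j) = (\<Sum>k'\<in>Ks. \<Sum>e\<in>Ek k'. Q2 Info (k, j) (k', e) * x (k', e))"
    unfolding mvec_def using assms(1,2) by (subst sum.Sigma) auto
  also have "\<dots> = (\<Sum>k'\<in>Ks. if k' = k then mvec (Ek k) Info (\<lambda>e. x (k, e)) j else 0)"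
    by (intro sum.cong) (auto simp: Q2_def mvec_def)
  finally show ?thesis using assms(1,3) by simp
qed

lemma Q2_injective:
  assumes Info: "pos_def_on {..<p} Info" and Ek: "\<forall>k\<in>{1..K}. Ek k \<subseteq> {..<p}"
    and zero: "\<forall>i\<in>PKset K p. mvec (Dset K Ek) (Q2 Info) x i = 0"
  shows "\<forall>d\<in>Dset K Ek. x d = 0"
proof
  fix d assume "d \<in> Dset K Ek"
  then obtain k e where d: "d = (k, e)" "k \<in> {1..K}" "e \<in> Ek k" by (auto simp: Dset_def)
  define xk where "xk e = (if e \<in> Ek k then x (k, e) else 0)" for e
  have finite_Ek: "\<forall>k\<in>{1..K}. finite (Ek k)" using Ek finite_subset by blast
  have "mvec {..<p} Info xk = mvec (Ek k) Info (\<lambda>e. x (k, e))"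
    unfolding xk_def by (rule mvec_restrict) (use Ek d(2) in auto)
  then have "mvec {..<p} Info xk j = 0" if "j < p" for j
    using zero that d(2) mvec_Q2[OF _ finite_Ek d(2), of Info x j] by (simp add: PKset_def Dset_def)
  then have "quad_form {..<p} Info xk = 0" by (simp add: quad_form_dot_on dot_on_def)
  then have "xk e = 0" using quad_form_pos[OF Info, of e xk] d Ek by fastforce
  then show "x d = 0" using d by (simp add: xk_def)
qed

lemma machine_proportions:
  fixes n K :: nat and Cset :: "nat \<Rightarrow> nat set"
  assumes C_sub: "\<forall>k\<le>K. Cset k \<subseteq> {..<n}" and C_cover: "(\<Union>k\<le>K. Cset k) = {..<n}"
    and C_disj: "\<forall>k\<le>K. \<forall>k'\<le>K. k \<noteq> k' \<longrightarrow> Cset k \<inter> Cset k' = {}"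
    and C_ne: "\<forall>k\<le>K. Cset k \<noteq> {}"
  shows "n > 0" "\<forall>k\<in>{1..K}. prop_of n (Cset k) > 0" "(\<Sum>k\<in>{1..K}. prop_of n (Cset k)) < 1"
proof -
  have finite_C: "finite (Cset k)" if "k \<le> K" for k using C_sub that finite_subset by blast
  have "card (\<Union>k\<le>K. Cset k) = (\<Sum>k\<le>K. card (Cset k))"
    by (rule card_UN_disjoint) (use finite_C C_disj in auto)
  then have "(\<Sum>k\<le>K. card (Cset k)) = n" using C_cover by simp
  moreover have "{..K} = insert 0 {1..K}" by auto
  moreover have "card (Cset 0) > 0" using C_ne finite_C by (simp add: card_gt_0_iff)
  ultimately have lt: "(\<Sum>k\<in>{1..K}. card (Cset k)) < n" by simp
  then show n_pos: "n > 0" by simp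
  show "\<forall>k\<in>{1..K}. prop_of n (Cset k) > 0"
    using C_ne finite_C n_pos by (auto simp: prop_of_def card_gt_0_iff)
  have "(\<Sum>k\<in>{1..K}. prop_of n (Cset k)) = real (\<Sum>k\<in>{1..K}. card (Cset k)) / real n"
    by (simp add: prop_of_def sum_divide_distrib)
  also have "\<dots> < 1" using lt n_pos by (simp del: of_nat_sum)
  finally show "(\<Sum>k\<in>{1..K}. prop_of n (Cset k)) < 1" .
qed

lemma selective_density_factorization:
  fixes K p :: nat and \<rho> :: "nat \<Rightarrow> real" and Info :: "nat \<Rightarrow> nat \<Rightarrow> real" and Ek :: "nat \<Rightarrow> nat set"
    and \<mu> v :: "nat \<Rightarrow> real" and r :: "nat \<times> nat \<Rightarrow> real"
  defines "E \<equiv> \<Union>k\<in>{1..K}. Ek k" and "D \<equiv> Dset K Ek" and "P \<equiv> PKset K p"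
  assumes Ek: "\<forall>k\<in>{1..K}. Ek k \<subseteq> {..<p}" and Info: "pos_def_on {..<p} Info"
    and \<rho>_pos: "\<forall>k\<in>{1..K}. \<rho> k > 0" and \<rho>_sum: "(\<Sum>k\<in>{1..K}. \<rho> k) < 1"
  shows "\<exists>C > 0. \<forall>b B.
    gauss_density E \<mu> (inv_on E Info) b * gauss_density ({..<p} - E) (\<lambda>_. 0) (schur E Info) v
      * gauss_density P (\<lambda>_. 0) (SigmaOmega \<rho> Info) (\<lambda>i. - mvec E (Q1 Info) b i + mvec D (Q2 Info) B i + r i)
    = C * gauss_density E (\<lambda>a. mvec E (PiM K p \<rho> Info Ek) \<mu> a + kappaV K p \<rho> Info Ek r a) (ThetaM K p \<rho> Info Ek) b
        * gauss_density D (\<lambda>d. mvec E (PsiM K p \<rho> Info Ek) b d + tauV K p \<rho> Info Ek r d) (GammaM K p \<rho> Info Ek) B"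
proof -
  have E_sub: "E \<subseteq> {..<p}" using Ek by (auto simp: E_def)
  have finite_E: "finite E" using E_sub finite_subset by blast
  have finite_P: "finite P" by (simp add: P_def PKset_def)
  have "D \<subseteq> P" using Ek by (auto simp: D_def P_def Dset_def PKset_def)
  then have finite_D: "finite D" using finite_P finite_subset by blast
  have Sigma_pos_def: "pos_def_on P (SigmaOmega \<rho> Info)"
    unfolding P_def by (rule SigmaOmega_pos_def[OF Info \<rho>_pos \<rho>_sum])
  have SigInv_eq: "SigInv K p \<rho> Info = inv_on P (SigmaOmega \<rho> Info)" by (simp add: SigInv_def P_def)
  interpret gaussian_conditioning E D P "Q1 Info" "Q2 Info" "SigInv K p \<rho> Info" Info
  proof
    show "pos_def_on P (SigInv K p \<rho> Info)"
      unfolding SigInv_eq by (rule inv_on_pos_def[OF finite_P Sigma_pos_def])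
    show "pos_def_on E Info" by (rule pos_def_on_subset[OF _ E_sub Info]) simp
    show "\<forall>d\<in>D. x d = 0" if "\<forall>i\<in>P. mvec D (Q2 Info) x i = 0" for x
      using Q2_injective[OF Info Ek] that by (simp add: D_def P_def)
  qed (fact finite_E finite_D finite_P)+
  have matrices: "GammaM K p \<rho> Info Ek = Gam" "PsiM K p \<rho> Info Ek = Psi" "ThetaM K p \<rho> Info Ek = Theta"
    "PiM K p \<rho> Info Ek = mmul E Theta Info" "tauV K p \<rho> Info Ek r = tau r" "kappaV K p \<rho> Info Ek r = kappa r"
    unfolding GammaM_def PsiM_def ThetaM_def PiM_def tauV_def kappaV_def Let_def
      E_def[symmetric] D_def[symmetric] P_def[symmetric]
    by (simp_all add: Gam_def G_def Psi_def Theta_def H_def tau_def kappa_def proj_def)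
  obtain C where C: "C > 0" "\<And>b B. gauss_density E \<mu> (inv_on E Info) b
        * gauss_density P (\<lambda>_. 0) (SigmaOmega \<rho> Info) (\<lambda>i. - mvec E (Q1 Info) b i + mvec D (Q2 Info) B i + r i)
      = C * gauss_density E (\<lambda>a. mvec E (mmul E Theta Info) \<mu> a + kappa r a) Theta b
          * gauss_density D (\<lambda>d. mvec E Psi b d + tau r d) Gam B"
    by (rule gauss_density_factorization[OF Sigma_pos_def SigInv_eq, of \<mu> r]) blast
  have "gauss_density ({..<p} - E) (\<lambda>_. 0) (schur E Info) v > 0"
    by (rule gauss_density_pos[OF _ schur_pos_def[OF _ E_sub Info]]) simp_all
  with C show ?thesis
    unfolding matrices by (intro exI[of _ "gauss_density ({..<p} - E) (\<lambda>_. 0) (schur E Info) v * C"]) auto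
qed

lemma stack_eq_iff: "stack K f = stack K g \<longleftrightarrow> (\<forall>k\<in>{1..K}. f k = g k)"
proof
  assume eq: "stack K f = stack K g"
  show "\<forall>k\<in>{1..K}. f k = g k"
  proof (intro ballI ext)
    fix k j assume "k \<in> {1..K}"
    then show "f k j = g k j" using fun_cong[OF eq, of "(k, j)"] by (simp add: stack_def)
  qed
qed (auto simp: stack_def fun_eq_iff)

lemma selection_event_eq:
  fixes \<beta> :: "nat \<Rightarrow> 'w \<Rightarrow> nat \<Rightarrow> real" and Zw :: "nat \<Rightarrow> 'w \<Rightarrow> nat \<rightharpoonup> real"
  assumes "c > 0"
  shows "{w. \<forall>k\<in>{1..K}. active p (\<beta> k w) = active p (\<beta> k w0) \<and> Smap p (\<beta> k w) = Smap p (\<beta> k w0)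
              \<and> Zw k w = Zw k w0}
    = {w. (\<lambda>i. map_option sgn (map_option (\<lambda>t. c * t) (stack K (\<lambda>k. Bmap p (\<beta> k w)) i)))
            = stack K (\<lambda>k. Smap p (\<beta> k w0))
          \<and> stack K (\<lambda>k. Zw k w) = stack K (\<lambda>k. Zw k w0)}"
proof -
  have "(\<lambda>i. map_option sgn (map_option (\<lambda>t. c * t) (stack K (\<lambda>k. Bmap p (\<beta> k w)) i)))
      = stack K (\<lambda>k. Smap p (\<beta> k w))" for w
    using assms by (auto simp: fun_eq_iff stack_def Smap_def option.map_comp comp_def sgn_mult)
  moreover have "active p \<beta>' = {j. Smap p \<beta>' j \<noteq> None}" for \<beta>'
    by (auto simp: Smap_def Bmap_def)
  ultimately show ?thesis by (auto simp: stack_eq_iff)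
qed

theorem theorem4p3:
  fixes A :: "real \<Rightarrow> real"           \<comment> \<open>cumulant function\<close>
    and n p K :: nat
    and Cset :: "nat \<Rightarrow> nat set"       \<comment> \<open>machine index sets C^(0),...,C^(K)\<close>
    and lam :: "nat \<Rightarrow> real"           \<comment> \<open>diagonal of \<Lambda>\<close>
    and xs :: "'w \<Rightarrow> nat \<Rightarrow> nat \<Rightarrow> real"  \<comment> \<open>random design, rows x_i\<close>
    and ys :: "'w \<Rightarrow> nat \<Rightarrow> real"       \<comment> \<open>random responses\<close>
    and bh :: "nat \<Rightarrow> 'w \<Rightarrow> nat \<Rightarrow> real" \<comment> \<open>local Lasso solutions\<close>
    and w0 :: 'w                        \<comment> \<open>observed outcome\<close>
    and Info :: "nat \<Rightarrow> nat \<Rightarrow> real"    \<comment> \<open>the matrix \<I>\<close>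
    and beta :: "nat \<Rightarrow> real"          \<comment> \<open>\<beta>_{E,n} (read on E)\<close>
  assumes K_pos: "K \<ge> 1"
    and C_sub: "\<forall>k\<le>K. Cset k \<subseteq> {..<n}"
    and C_cover: "(\<Union>k\<le>K. Cset k) = {..<n}"
    and C_disj: "\<forall>k\<le>K. \<forall>k'\<le>K. k \<noteq> k' \<longrightarrow> Cset k \<inter> Cset k' = {}"
    and C_ne: "\<forall>k\<le>K. Cset k \<noteq> {}"
    and lam_pos: "\<forall>j<p. lam j > 0"
    and lasso: "\<forall>w. \<forall>k\<in>{1..K}. (\<forall>j\<ge>p. bh k w j = 0) \<and>
                  (\<forall>b. (\<forall>j\<ge>p. b j = 0) \<longrightarrow>
                     lasso_obj A n p (Cset k) lam (xs w) (ys w) (bh k w)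
                       \<le> lasso_obj A n p (Cset k) lam (xs w) (ys w) b)"
    and Info_pd: "pos_def_on {..<p} Info"
  shows
    "{w. \<forall>k\<in>{1..K}. active p (bh k w) = active p (bh k w0)
            \<and> Smap p (bh k w) = Smap p (bh k w0)
            \<and> Zmap p lam (bh k w) (neg_grad A n p (Cset k) (xs w) (ys w) (bh k w))
              = Zmap p lam (bh k w0) (neg_grad A n p (Cset k) (xs w0) (ys w0) (bh k w0))}
     = {w. (\<lambda>i. map_option sgn (map_option (\<lambda>t. sqrt (real n) * t) (stack K (\<lambda>k. Bmap p (bh k w)) i)))
              = stack K (\<lambda>k. Smap p (bh k w0))
           \<and> stack K (\<lambda>k. Zmap p lam (bh k w) (neg_grad A n p (Cset k) (xs w) (ys w) (bh k w)))
              = stack K (\<lambda>k. Zmap p lam (bh k w0) (neg_grad A n p (Cset k) (xs w0) (ys w0) (bh k w0)))}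
   \<and>
    (let \<rho> = (\<lambda>k. prop_of n (Cset k));
         Ek = (\<lambda>k. active p (bh k w0));
         E = (\<Union>k\<in>{1..K}. Ek k);
         mE = {..<p} - E;
         D = Dset K Ek;
         P = PKset K p;
         S = stack K (\<lambda>k. Smap p (bh k w0));
         Z = stack K (\<lambda>k. Zmap p lam (bh k w0) (neg_grad A n p (Cset k) (xs w0) (ys w0) (bh k w0)))
     in \<forall>v :: nat \<Rightarrow> real. \<exists>C > 0. \<forall>(b :: nat \<Rightarrow> real) (B :: nat \<times> nat \<Rightarrow> real).
          let r = rV K Ek lam S Z v in
          gauss_density E (\<lambda>a. sqrt (real n) * beta a) (inv_on E Info) b
          * gauss_density mE (\<lambda>_. 0) (schur E Info) v
          * gauss_density P (\<lambda>_. 0) (SigmaOmega \<rho> Info)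
              (\<lambda>i. - mvec E (Q1 Info) b i + mvec D (Q2 Info) B i + r i)
          = C * gauss_density E
                  (\<lambda>a. mvec E (PiM K p \<rho> Info Ek) (\<lambda>e. sqrt (real n) * beta e) a + kappaV K p \<rho> Info Ek r a)
                  (ThetaM K p \<rho> Info Ek) b
              * gauss_density D
                  (\<lambda>d. mvec E (PsiM K p \<rho> Info Ek) b d + tauV K p \<rho> Info Ek r d)
                  (GammaM K p \<rho> Info Ek) B)"
proof -
  obtain n_pos: "n > 0" and \<rho>_pos: "\<forall>k\<in>{1..K}. prop_of n (Cset k) > 0"
    and \<rho>_sum: "(\<Sum>k\<in>{1..K}. prop_of n (Cset k)) < 1"
    using machine_proportions[OF C_sub C_cover C_disj C_ne] by blast
  have active_sub: "\<forall>k\<in>{1..K}. active p (bh k w0) \<subseteq> {..<p}" by (auto simp: active_def)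
  show ?thesis
    unfolding Let_def
    by (intro conjI allI selection_event_eq
        selective_density_factorization[OF active_sub Info_pd \<rho>_pos \<rho>_sum]) (simp add: n_pos)
qed

end
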